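(* Let $X$ be a fiber bundle (in the sense of the context) with charts $X_s\cong U_s\times\mathbb{C}^k$, $s\in S$, and let $\omega$ be a $\bar\partial$-closed $(0,1)$-form of class $C^1$ on $X$ which is decreasing along the fibers (in the sense of the context). Then there exists a globally defined $C^1$ function $B: X\to\mathbb{C}$ such that: 1. $\bar\partial B=\omega$ on $X$. 2. For every chart $X_s$ and every compact set $K\subset U_s$, with $\varepsilon=\varepsilon(s,K)>0$ an exponent from the decreasing condition for $\omega$ on $K$, there is a constant $\mathrm{const}>0$ depending on $K$ such that in the coordinates $(z,w)$ of $X_s$, for all $z\in K$, $w\in\mathbb{C}^k$ and every $\delta=1,\dots,k$, $$|B(z,w)|\le \mathrm{const}\int_{\mathbb{C}}\frac{1}{|\zeta|}\cdot\frac{1}{1+\|w'\|^{1+\varepsilon}+\big||w_\delta|+\zeta\big|^{1+\varepsilon}}\,|d\zeta\wedge d\bar\zeta| .$$ 3. In each chart $X_s$, $B(z,w)$ is bounded, uniformly when $z$ runs over a compact set: for every compact $K\subset U_s$, $B$ is bounded on $K\times\mathbb{C}^k$. 4. In each chart $X_s$ and for each $\delta=1,\dots,k$, $\lim_{|w_\delta|\to\infty}B(z,w)=0$, uniformly when $z$ runs over a compact subset of $U_s$ and $w'=(w_1,\dots,w_{\delta-1},w_{\delta+1},\dots,w_k)$ is arbitrary.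
   Context: Fiber bundle. Fix integers $n,k\ge 1$. A fiber bundle is a connected complex manifold $X$ of complex dimension $n+k$ with a locally finite open cover $\{X_s\}_{s\in S}$ and biholomorphic coordinate maps $X_s\to U_s\times\mathbb{C}^k$, with $U_s$ a domain in $\mathbb{C}^n$; the coordinates on $X_s$ are $(z,w)=(z_s,w_s)=(z_1,\dots,z_n,w_1,\dots,w_k)$. The transition maps between charts have the form $(z_s,w_s)=(f_{st}(z_t),g_{st}(z_t,w_t))$, $s,t\in S$, where $f_{st}$ depends on $z_t$ only and, for each $z_t$ in the overlap, $w_t\mapsto g_{st}(z_t,w_t)$ is a biholomorphism of $\mathbb{C}^k$ onto $\mathbb{C}^k$ (so overlaps consist of whole fibers). Notation. $z_\alpha=x_\alpha+iy_\alpha$, $w_\gamma=u_\gamma+iv_\gamma$; $|w|=(|w_1|^2+\dots+|w_k|^2)^{1/2}$. For a given index $\delta$, $w'=(w_1,\dots,w_{\delta-1},w_{\delta+1},\dots,w_k)$ and $\|w'\|^{1+\varepsilon}$ denotes $\sum_{j\ne\delta}|w_j|^{1+\varepsilon}$ (equal to $0$ if $k=1$). For $\zeta=\xi+i\eta$, $|d\zeta\wedge d\bar\zeta|=2\,d\xi\,d\eta$. Forms. In a chart a $(0,1)$-form of class $C^1$ is written $\omega(z,w)=\sum_{\alpha=1}^n a_\alpha(z,w)\,d\bar z_\alpha+\sum_{\gamma=1}^k b_\gamma(z,w)\,d\bar w_\gamma$ with $C^1$ complex-valued coefficients. Decreasing along the fibers. $\omega$ is decreasing along the fibers if in each chart $X_s\cong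 U_s\times\mathbb{C}^k$ and for each compact $K\subset U_s$ there exist $\varepsilon=\varepsilon(s,K)>0$ and $C=C(s,K,\varepsilon)$ such that: (i) $\lim_{|w|\to\infty}a_\alpha(z,w)=0$ uniformly in $z\in K$, for $\alpha=1,\dots,n$; (ii) $|b_\gamma(z,w)|\le \dfrac{C}{1+|w_1|^{1+\varepsilon}+\dots+|w_k|^{1+\varepsilon}}$ for all $z\in K$, $w\in\mathbb{C}^k$, $\gamma=1,\dots,k$; (iii) $|Db_\gamma(z,w)|\le \dfrac{C}{1+|w_1|^{1+\varepsilon}+\dots+|w_k|^{1+\varepsilon}}$ for all $z\in K$, $w\in\mathbb{C}^k$, $\gamma=1,\dots,k$, where $D$ is any of $\partial/\partial x_\beta,\ \partial/\partial y_\beta$ ($\beta=1,\dots,n$), $\partial/\partial u_\delta,\ \partial/\partial v_\delta$ ($\delta=1,\dots,k$). *)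

theory Defs
  imports "HOL-Analysis.Analysis"
begin

section \<open>Coordinates on the model space\<close>

text \<open>
  The model space \<^typ>\<open>(complex^'n) \<times> (complex^'k)\<close> carries the coordinates
  \<open>(z\<^sub>1, \<dots>, z\<^sub>n, w\<^sub>1, \<dots>, w\<^sub>k)\<close>, indexed by the sum type \<^typ>\<open>'n + 'k\<close>.
\<close>

type_synonym ('n, 'k) model = "(complex^'n) \<times> (complex^'k)"

fun coord_vec :: "'n + 'k \<Rightarrow> complex \<Rightarrow> ('n::finite, 'k::finite) model" where
  "coord_vec (Inl \<alpha>) c = (axis \<alpha> c, 0)"
| "coord_vec (Inr \<gamma>) c = (0, axis \<gamma> c)"

fun coord :: "'n + 'k \<Rightarrow> ('n::finite, 'k::finite) model \<Rightarrow> complex" where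
  "coord (Inl \<alpha>) v = fst v $ \<alpha>"
| "coord (Inr \<gamma>) v = snd v $ \<gamma>"

definition model_scale :: "complex \<Rightarrow> ('n::finite, 'k::finite) model \<Rightarrow> ('n, 'k) model" where
  "model_scale c v = (c *s fst v, c *s snd v)"

definition dir_deriv ::
  "'a::real_normed_vector \<Rightarrow> ('a \<Rightarrow> 'b::real_normed_vector) \<Rightarrow> 'a \<Rightarrow> 'b" where
  "dir_deriv v F p = frechet_derivative F (at p) v"

abbreviation partial_re ::
  "'n + 'k \<Rightarrow> (('n::finite, 'k::finite) model \<Rightarrow> complex) \<Rightarrow> ('n, 'k) model \<Rightarrow> complex" where
  "partial_re i \<equiv> dir_deriv (coord_vec i 1)"

abbreviation partial_im ::
  "'n + 'k \<Rightarrow> (('n::finite, 'k::finite) model \<Rightarrow> complex) \<Rightarrow> ('n, 'k) model \<Rightarrow> complex" where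
  "partial_im i \<equiv> dir_deriv (coord_vec i \<i>)"

text \<open>The Wirtinger derivative with respect to the conjugate of the \<open>i\<close>-th coordinate.\<close>

definition partial_bar ::
  "'n + 'k \<Rightarrow> (('n::finite, 'k::finite) model \<Rightarrow> complex) \<Rightarrow> ('n, 'k) model \<Rightarrow> complex" where
  "partial_bar i F p = (partial_re i F p + \<i> * partial_im i F p) / 2"

text \<open>The next two notions are meant for open sets \<open>A\<close>.\<close>

definition C1_on :: "'a::real_normed_vector set \<Rightarrow> ('a \<Rightarrow> 'b::real_normed_vector) \<Rightarrow> bool" where
  "C1_on A F \<longleftrightarrow>
     (\<forall>p\<in>A. F differentiable (at p)) \<and> (\<forall>v. continuous_on A (dir_deriv v F))"

text \<open>
  Holomorphy in several variables: the real derivative exists and is linear over the complex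
  numbers. The arguments \<open>sa\<close> and \<open>sb\<close> are the complex scalar multiplications of the two spaces.
\<close>

definition holomorphic_map_on ::
  "(complex \<Rightarrow> 'a \<Rightarrow> 'a) \<Rightarrow> (complex \<Rightarrow> 'b \<Rightarrow> 'b) \<Rightarrow> 'a::real_normed_vector set \<Rightarrow>
   ('a \<Rightarrow> 'b::real_normed_vector) \<Rightarrow> bool" where
  "holomorphic_map_on sa sb A F \<longleftrightarrow>
     (\<forall>p\<in>A. \<exists>F'. (F has_derivative F') (at p) \<and> (\<forall>c v. F' (sa c v) = sb c (F' v)))"

definition biholomorphism :: "((complex^'k::finite) \<Rightarrow> (complex^'k)) \<Rightarrow> bool" where
  "biholomorphism h \<longleftrightarrow>
     bij h \<and> holomorphic_map_on (*s) (*s) UNIV h \<and> holomorphic_map_on (*s) (*s) UNIV (inv h)"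

section \<open>Complex manifolds and fiber bundles\<close>

definition transition ::
  "('s \<Rightarrow> 'x set) \<Rightarrow> ('s \<Rightarrow> 'x \<Rightarrow> 'e) \<Rightarrow> 's \<Rightarrow> 's \<Rightarrow> 'e \<Rightarrow> 'e" where
  "transition D \<phi> s t p = \<phi> s (inv_into (D t) (\<phi> t) p)"

text \<open>
  The complex structure of \<open>X\<close> is the one given by the holomorphic atlas of charts
  \<open>\<phi> s : D s \<rightarrow> \<phi> s ` D s\<close>, \<open>s \<in> S\<close>; with respect to it, the charts are biholomorphic.
  The complex dimension is \<^term>\<open>CARD('n) + CARD('k)\<close>.
\<close>

locale complex_manifold =
  fixes X :: "'x topology"
    and S :: "'s set"
    and D :: "'s \<Rightarrow> 'x set"
    and \<phi> :: "'s \<Rightarrow> 'x \<Rightarrow> ('n::finite, 'k::finite) model"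
  assumes Hausdorff: "Hausdorff_space X"
    and second_countable: "second_countable X"
    and chart_open: "s \<in> S \<Longrightarrow> openin X (D s)"
    and chart_cover: "(\<Union>s\<in>S. D s) = topspace X"
    and chart_image_open: "s \<in> S \<Longrightarrow> open (\<phi> s ` D s)"
    and chart_homeo:
      "s \<in> S \<Longrightarrow> homeomorphic_map (subtopology X (D s)) (top_of_set (\<phi> s ` D s)) (\<phi> s)"
    and transition_holomorphic:
      "\<lbrakk>s \<in> S; t \<in> S\<rbrakk> \<Longrightarrow>
         holomorphic_map_on model_scale model_scale (\<phi> t ` (D s \<inter> D t)) (transition D \<phi> s t)"

locale fiber_bundle = complex_manifold X S D \<phi>
  for X :: "'x topology"
    and S :: "'s set"
    and D :: "'s \<Rightarrow> 'x set"
    and U :: "'s \<Rightarrow> (complex^'n::finite) set"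
    and \<phi> :: "'s \<Rightarrow> 'x \<Rightarrow> ('n, 'k::finite) model" +
  assumes connected: "connected_space X"
    and locally_finite:
      "x \<in> topspace X \<Longrightarrow> \<exists>V. openin X V \<and> x \<in> V \<and> finite {s \<in> S. D s \<inter> V \<noteq> {}}"
    and base_domain: "s \<in> S \<Longrightarrow> open (U s) \<and> connected (U s) \<and> U s \<noteq> {}"
    and chart_image: "s \<in> S \<Longrightarrow> \<phi> s ` D s = U s \<times> UNIV"
    and transition_fibered:
      "\<lbrakk>s \<in> S; t \<in> S\<rbrakk> \<Longrightarrow> \<exists>V f g. \<phi> t ` (D s \<inter> D t) = V \<times> UNIV \<and>
         (\<forall>z\<in>V. \<forall>w. transition D \<phi> s t (z, w) = (f z, g z w)) \<and>
         (\<forall>z\<in>V. biholomorphism (g z))"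

definition local_rep ::
  "('s \<Rightarrow> 'x set) \<Rightarrow> ('s \<Rightarrow> 'x \<Rightarrow> 'e) \<Rightarrow> 's \<Rightarrow> ('x \<Rightarrow> complex) \<Rightarrow> 'e \<Rightarrow> complex" where
  "local_rep D \<phi> s B p = B (inv_into (D s) (\<phi> s) p)"

definition C1_function ::
  "'s set \<Rightarrow> ('s \<Rightarrow> 'x set) \<Rightarrow> ('s \<Rightarrow> 'x \<Rightarrow> ('n::finite, 'k::finite) model) \<Rightarrow>
   ('x \<Rightarrow> complex) \<Rightarrow> bool" where
  "C1_function S D \<phi> B \<longleftrightarrow> (\<forall>s\<in>S. C1_on (\<phi> s ` D s) (local_rep D \<phi> s B))"

section \<open>Forms of type (0,1)\<close>

text \<open>
  A (0,1)-form in a chart is given by its coefficient functions: \<open>\<eta> (Inl \<alpha>)\<close> is the coefficient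
  \<open>a\<^sub>\<alpha>\<close> of the conjugate differential of \<open>z\<^sub>\<alpha>\<close>, and \<open>\<eta> (Inr \<gamma>)\<close> is the coefficient
  \<open>b\<^sub>\<gamma>\<close> of that of \<open>w\<^sub>\<gamma>\<close>. The value of the form at \<open>p\<close> on the real tangent vector \<open>v\<close> is
  \<open>form_eval \<eta> p v\<close>.
\<close>

type_synonym ('n, 'k) form01 = "'n + 'k \<Rightarrow> ('n, 'k) model \<Rightarrow> complex"

definition form_eval ::
  "('n::finite, 'k::finite) form01 \<Rightarrow> ('n, 'k) model \<Rightarrow> ('n, 'k) model \<Rightarrow> complex" where
  "form_eval \<eta> p v = (\<Sum>i\<in>UNIV. \<eta> i p * cnj (coord i v))"

text \<open>
  A form on the manifold is a family of forms in the charts that are pulled back to each other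
  by the transition maps.
\<close>

definition C1_form01 ::
  "'s set \<Rightarrow> ('s \<Rightarrow> 'x set) \<Rightarrow> ('s \<Rightarrow> 'x \<Rightarrow> ('n::finite, 'k::finite) model) \<Rightarrow>
   ('s \<Rightarrow> ('n, 'k) form01) \<Rightarrow> bool" where
  "C1_form01 S D \<phi> \<omega> \<longleftrightarrow>
     (\<forall>s\<in>S. \<forall>i. C1_on (\<phi> s ` D s) (\<omega> s i)) \<and>
     (\<forall>s\<in>S. \<forall>t\<in>S. \<forall>p\<in>\<phi> t ` (D s \<inter> D t). \<forall>v.
        form_eval (\<omega> t) p v =
        form_eval (\<omega> s) (transition D \<phi> s t p) (dir_deriv v (transition D \<phi> s t) p))"

text \<open>
  \<open>dbar_coeff \<eta> i j\<close> is the coefficient in \<open>\<partial>\<close>-bar of \<open>\<eta>\<close> of the wedge product of the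
  conjugate differentials of the \<open>i\<close>-th and the \<open>j\<close>-th coordinate (in that order).
\<close>

definition dbar_coeff ::
  "('n::finite, 'k::finite) form01 \<Rightarrow> 'n + 'k \<Rightarrow> 'n + 'k \<Rightarrow> ('n, 'k) model \<Rightarrow> complex" where
  "dbar_coeff \<eta> i j p = partial_bar i (\<eta> j) p - partial_bar j (\<eta> i) p"

definition dbar_closed ::
  "'s set \<Rightarrow> ('s \<Rightarrow> 'x set) \<Rightarrow> ('s \<Rightarrow> 'x \<Rightarrow> ('n::finite, 'k::finite) model) \<Rightarrow>
   ('s \<Rightarrow> ('n, 'k) form01) \<Rightarrow> bool" where
  "dbar_closed S D \<phi> \<omega> \<longleftrightarrow> (\<forall>s\<in>S. \<forall>i j. \<forall>p\<in>\<phi> s ` D s. dbar_coeff (\<omega> s) i j p = 0)"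

definition dbar_eq ::
  "'s set \<Rightarrow> ('s \<Rightarrow> 'x set) \<Rightarrow> ('s \<Rightarrow> 'x \<Rightarrow> ('n::finite, 'k::finite) model) \<Rightarrow>
   ('x \<Rightarrow> complex) \<Rightarrow> ('s \<Rightarrow> ('n, 'k) form01) \<Rightarrow> bool" where
  "dbar_eq S D \<phi> B \<omega> \<longleftrightarrow>
     (\<forall>s\<in>S. \<forall>i. \<forall>p\<in>\<phi> s ` D s. partial_bar i (local_rep D \<phi> s B) p = \<omega> s i p)"

section \<open>Decrease along the fibers\<close>

definition fiber_weight :: "real \<Rightarrow> complex^'k::finite \<Rightarrow> real" where
  "fiber_weight \<epsilon> w = 1 + (\<Sum>j\<in>UNIV. norm (w $ j) powr (1 + \<epsilon>))"

text \<open>\<open>\<epsilon>\<close> is an admissible exponent over \<open>K\<close> for the form \<open>\<eta>\<close> in a chart.\<close>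

definition decreasing_exponent ::
  "('n::finite, 'k::finite) form01 \<Rightarrow> (complex^'n) set \<Rightarrow> real \<Rightarrow> bool" where
  "decreasing_exponent \<eta> K \<epsilon> \<longleftrightarrow> \<epsilon> > 0 \<and>
     (\<forall>\<alpha>. uniform_limit K (\<lambda>w z. \<eta> (Inl \<alpha>) (z, w)) (\<lambda>z. 0) at_infinity) \<and>
     (\<exists>C. \<forall>z\<in>K. \<forall>w. \<forall>\<gamma>.
        norm (\<eta> (Inr \<gamma>) (z, w)) \<le> C / fiber_weight \<epsilon> w \<and>
        (\<forall>i. norm (partial_re i (\<eta> (Inr \<gamma>)) (z, w)) \<le> C / fiber_weight \<epsilon> w \<and>
             norm (partial_im i (\<eta> (Inr \<gamma>)) (z, w)) \<le> C / fiber_weight \<epsilon> w))"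

definition decreasing_along_fibers ::
  "'s set \<Rightarrow> ('s \<Rightarrow> (complex^'n) set) \<Rightarrow> ('s \<Rightarrow> ('n::finite, 'k::finite) form01) \<Rightarrow> bool" where
  "decreasing_along_fibers S U \<omega> \<longleftrightarrow>
     (\<forall>s\<in>S. \<forall>K. compact K \<and> K \<subseteq> U s \<longrightarrow> (\<exists>\<epsilon>. decreasing_exponent (\<omega> s) K \<epsilon>))"

text \<open>The factor 2 accounts for \<open>|d\<zeta> \<and> d\<zeta>\<close>-bar\<open>| = 2 d\<xi> d\<eta>\<close>.\<close>

definition kernel_bound :: "real \<Rightarrow> 'k \<Rightarrow> complex^'k::finite \<Rightarrow> real" where
  "kernel_bound \<epsilon> \<delta> w =
     2 * (LINT \<zeta>|lborel. 1 / norm \<zeta> *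
       (1 / (1 + (\<Sum>j\<in>UNIV - {\<delta>}. norm (w $ j) powr (1 + \<epsilon>))
               + norm (complex_of_real (norm (w $ \<delta>)) + \<zeta>) powr (1 + \<epsilon>))))"

end

theory Submission
  imports Defs "HOL-Complex_Analysis.Cauchy_Integral_Formula" "HOL-Real_Asymp.Real_Asymp"
begin

text \<open>
  In a chart, the Cauchy transform of the coefficient \<open>b\<^sub>\<delta>\<close> in the fiber variable \<open>w\<^sub>\<delta>\<close>,
  that is \<open>- 1 / \<pi>\<close> times the integral of \<open>b\<^sub>\<delta> (z, w + \<zeta> e\<^sub>\<delta>) / \<zeta>\<close> over the plane, solves the
  equation in all variables at once: closedness replaces a conjugate derivative of \<open>b\<^sub>\<delta>\<close> by the
  conjugate \<open>w\<^sub>\<delta>\<close>-derivative of another coefficient, which the Cauchy--Pompeiu formula on the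
  whole plane integrates back because the coefficients vanish at infinity. Each of these solutions
  is bounded by the kernel integral and tends to 0 as \<open>|w\<^sub>\<delta>|\<close> tends to infinity. Since the
  difference of two solutions is holomorphic and bounded on the fibers, Liouville's theorem shows
  that they depend neither on \<open>\<delta>\<close> nor on the chart, hence they glue.
\<close>

section \<open>The Cauchy--Pompeiu formula on the plane\<close>

text \<open>The base coefficients \<open>\<eta> (Inl \<alpha>)\<close> are only known to tend to 0
  along the fibers, with no rate and no bound on their derivatives, and this shapes the proof. They
  are never integrated against the Cauchy kernel; only the fiber coefficients and their derivatives
  are. Accordingly the Cauchy--Pompeiu formula is established for C1 functions that vanish at
  infinity, with integrability of the conjugate derivative divided by \<open>z\<close> as a separate
  hypothesis, which closedness supplies. A single transform is seen to decay only as
  \<open>|w\<^sub>\<delta>|\<close> grows. Independence of \<delta> upgrades this to decay as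
  \<open>|w|\<close> grows, a property that survives the fiberwise biholomorphisms, which need not
  respect the coordinates of the fiber. Decay at a common point also forces the constant left over
  by Liouville's theorem to be 0, so the local solutions agree on overlaps exactly and no cocycle
  has to be corrected.\<close>

lemma cball_borel_measurable [measurable]: "cball (x::'a::metric_space) r \<in> sets borel"
  by (intro borel_closed closed_cball)

lemma lborel_integral_translate:
  fixes f :: "'a::euclidean_space \<Rightarrow> 'b::{banach, second_countable_topology}"
  assumes "f \<in> borel_measurable borel"
  shows "(LINT x|lborel. f (c + x)) = (LINT x|lborel. f x)"
proof -
  have "(LINT x|lborel. f x) = (LINT x|distr lborel borel ((+) c). f x)" by (simp add: lborel_distr_plus)
  then show ?thesis using assms by (simp add: integral_distr)
qed

lemma lborel_integrable_translate:
  fixes f :: "'a::euclidean_space \<Rightarrow> 'b::{banach, second_countable_topology}"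
  assumes "integrable lborel f"
  shows "integrable lborel (\<lambda>x. f (c + x))"
proof -
  have "integrable (distr lborel borel ((+) c)) f" using assms by (simp add: lborel_distr_plus)
  then show ?thesis using assms by (subst (asm) integrable_distr_eq) auto
qed

lemma lborel_integral_scale_complex:
  fixes f :: "complex \<Rightarrow> complex" and r :: real
  assumes [measurable]: "f \<in> borel_measurable borel" and "r > 0"
  shows "(LINT x|lborel. f x) = r\<^sup>2 * (LINT x|lborel. f (of_real r * x))"
proof -
  have "(LINT x|lborel. f x) = (LINT x|density (distr lborel borel (\<lambda>x::complex. 0 + r *\<^sub>R x)) (\<lambda>_. ennreal (r\<^sup>2)). f x)"
    using lborel_affine[of r "0::complex"] \<open>r > 0\<close> by (simp add: ennreal_power)
  also have "\<dots> = (LINT x|distr lborel borel (\<lambda>x::complex. 0 + r *\<^sub>R x). r\<^sup>2 *\<^sub>R f x)"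
    by (rule integral_density) auto
  also have "\<dots> = (LINT x|lborel. r\<^sup>2 *\<^sub>R f (of_real r * x))"
    by (subst integral_distr) (auto simp: scaleR_conv_of_real)
  finally show ?thesis by (simp add: scaleR_conv_of_real)
qed

text \<open>The difference quotients have integral zero by
  translation invariance, and dominated convergence applies to them.\<close>

lemma integral_dir_derivative_eq_0:
  fixes h :: "complex \<Rightarrow> complex"
  assumes lip: "\<And>x y. norm (h x - h y) \<le> L * norm (x - y)"
    and supp: "\<And>x. norm x > R \<Longrightarrow> h x = 0"
    and lim: "AE x in lborel. (\<lambda>n. of_nat (Suc n) * (h (v / of_nat (Suc n) + x) - h x)) \<longlonglongrightarrow> f x"
    and [measurable]: "f \<in> borel_measurable lborel"
  shows "integrable lborel f" "(LINT x|lborel. f x) = 0"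
proof -
  have "L \<ge> 0" using order_trans[OF norm_ge_zero lip[of 1 0]] by simp
  have "L-lipschitz_on UNIV h"
    using lip \<open>L \<ge> 0\<close> by (intro lipschitz_onI) (auto simp: dist_norm)
  then have "continuous_on UNIV h" by (rule lipschitz_on_continuous_on)
  then have [measurable]: "h \<in> borel_measurable borel" by (rule borel_measurable_continuous_onI)
  have fin: "integrable lborel (\<lambda>x. K * indicator (cball (0::complex) r) x :: real)" for K r
    by (intro integrable_mult_right integrable_real_indicator emeasure_lborel_cball_finite) auto
  have hint: "integrable lborel h"
  proof (rule Bochner_Integration.integrable_bound)
    show "integrable lborel (\<lambda>x. L * (2 * \<bar>R\<bar> + 1) * indicator (cball (0::complex) R) x)" by (rule fin)
    have "norm (h x) \<le> L * (2 * \<bar>R\<bar> + 1) * indicator (cball (0::complex) R) x" for x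
    proof (cases "norm x \<le> R")
      case True
      \<comment> \<open>The point \<open>\<bar>R\<bar> + 1\<close> lies outside the support, so the
        Lipschitz bound against it controls \<open>h\<close> on the disc. The absolute value covers
        negative \<open>R\<close>.\<close>
      have "h (of_real (\<bar>R\<bar> + 1)) = 0" by (rule supp) (simp only: norm_of_real)
      then have "norm (h x) \<le> L * norm (x - of_real (\<bar>R\<bar> + 1))" using lip[of x "of_real (\<bar>R\<bar> + 1)"] by simp
      also have "norm (x - of_real (\<bar>R\<bar> + 1)) \<le> norm x + norm (complex_of_real (\<bar>R\<bar> + 1))" by (rule norm_triangle_ineq4)
      also have "\<dots> \<le> 2 * \<bar>R\<bar> + 1" using True by (simp only: norm_of_real)
      finally show ?thesis using True \<open>L \<ge> 0\<close> by (simp add: mult_left_mono)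
    qed (simp add: supp)
    then show "AE x in lborel. norm (h x) \<le> norm (L * (2 * \<bar>R\<bar> + 1) * indicator (cball (0::complex) R) x)"
      by (auto intro!: AE_I2 order_trans[OF _ abs_ge_self])
  qed auto
  define s where "s n x = of_nat (Suc n) * (h (v / of_nat (Suc n) + x) - h x)" for n x
  have [measurable]: "s n \<in> borel_measurable lborel" for n unfolding s_def by measurable
  have s0: "(LINT x|lborel. s n x) = 0" for n
    unfolding s_def using hint lborel_integrable_translate[OF hint, of "v / of_nat (Suc n)"]
    by (simp add: lborel_integral_translate)
  \<comment> \<open>The steps \<open>v / of_nat (Suc n)\<close> have norm at most
    \<open>norm v\<close>, so all difference quotients vanish outside the disc of radius
    \<open>R + norm v\<close>; the Lipschitz bound gives \<open>L * norm v\<close> inside.\<close>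
  define W where "W x = L * norm v * indicator (cball (0::complex) (R + norm v)) x" for x
  have W: "integrable lborel W" unfolding W_def by (rule fin)
  have bd: "norm (s n x) \<le> W x" for n x
  proof (cases "norm x \<le> R + norm v")
    case True
    have "norm (s n x) = of_nat (Suc n) * norm (h (v / of_nat (Suc n) + x) - h x)"
      by (simp only: s_def norm_mult norm_of_nat)
    also have "\<dots> \<le> of_nat (Suc n) * (L * norm (v / of_nat (Suc n) + x - x))"
      by (intro mult_left_mono lip) auto
    also have "\<dots> = L * norm v" by (simp add: norm_divide field_simps del: of_nat_Suc)
    finally show ?thesis using True by (simp add: W_def)
  next
    case False
    have "norm (v / of_nat (Suc n)) \<le> norm v"
      by (simp add: norm_divide divide_le_eq mult_le_cancel_left1 del: of_nat_Suc)
    then have "norm (v / of_nat (Suc n) + x) > R"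
      using False norm_diff_triangle_ineq[of x 0 "- (v / of_nat (Suc n))" 0]
        norm_triangle_ineq2[of x "- (v / of_nat (Suc n))"] by (simp add: add.commute del: of_nat_Suc)
    moreover have "norm x > R" using False norm_ge_zero[of v] by linarith
    ultimately show ?thesis using False by (simp add: s_def W_def supp del: of_nat_Suc)
  qed
  have lim': "AE x in lborel. (\<lambda>n. s n x) \<longlonglongrightarrow> f x" using lim by (simp add: s_def)
  show "integrable lborel f"
    by (rule integrable_dominated_convergence[OF _ _ W lim']) (auto simp: bd)
  have "(\<lambda>n. LINT x|lborel. s n x) \<longlonglongrightarrow> (LINT x|lborel. f x)"
    by (rule integral_dominated_convergence[OF _ _ W lim']) (auto simp: bd)
  then show "(LINT x|lborel. f x) = 0" by (simp add: s0 LIMSEQ_const_iff)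
qed

text \<open>This truncation of the Cauchy kernel is Lipschitz, and its Wirtinger derivative with respect
  to the conjugate variable is \<open>1 / r\<^sup>2\<close> times the indicator of the disc of radius \<open>r\<close>, so that it
  produces averages over discs. The difference of two of them has compact support.\<close>

definition trunc_kernel :: "real \<Rightarrow> complex \<Rightarrow> complex" where
  "trunc_kernel r z = (if norm z < r then cnj z / r\<^sup>2 else 1 / z)"

definition trunc_kernel_deriv :: "real \<Rightarrow> complex \<Rightarrow> complex \<Rightarrow> complex" where
  "trunc_kernel_deriv r v z = (if norm z < r then cnj v / r\<^sup>2 else - v / z\<^sup>2)"

text \<open>The two branches match on the circle, where \<open>cnj z / r\<^sup>2\<close> equals
  \<open>1 / z\<close>. The constant 3 comes from points on different sides of it: the numerator
  splits into a term bounded by \<open>norm (x - y) * norm y\<close> and one bounded by twice that,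
  since \<open>norm y - r\<close> is at most \<open>norm (x - y)\<close>.\<close>

lemma trunc_kernel_lipschitz:
  assumes r: "r > 0"
  shows "norm (trunc_kernel r x - trunc_kernel r y) \<le> 3 / r\<^sup>2 * norm (x - y)"
proof -
  have mixed: "norm (cnj x / r\<^sup>2 - 1 / y) \<le> 3 / r\<^sup>2 * norm (x - y)" if "norm x < r" "norm y \<ge> r" for x y :: complex
  proof -
    have y: "y \<noteq> 0" "norm y > 0" using that r by auto
    have "cnj x / r\<^sup>2 - 1 / y = (cnj x * y - r\<^sup>2) / (r\<^sup>2 * y)" using y r by (simp add: field_simps)
    also have "cnj x * y - r\<^sup>2 = cnj (x - y) * y + of_real ((norm y)\<^sup>2 - r\<^sup>2)"
      using complex_norm_square[of y] by (simp add: algebra_simps)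
    finally have "norm (cnj x / r\<^sup>2 - 1 / y) = norm (cnj (x - y) * y + of_real ((norm y)\<^sup>2 - r\<^sup>2)) / (r\<^sup>2 * norm y)"
      using r by (simp add: norm_divide norm_mult norm_power)
    also have "\<dots> \<le> (norm (x - y) * norm y + 2 * norm (x - y) * norm y) / (r\<^sup>2 * norm y)"
    proof (intro divide_right_mono order_trans[OF norm_triangle_ineq] add_mono)
      have "norm (of_real ((norm y)\<^sup>2 - r\<^sup>2) :: complex) = (norm y)\<^sup>2 - r\<^sup>2"
        unfolding norm_of_real using that r by (simp add: power_mono)
      also have "\<dots> = (norm y - r) * (norm y + r)" by (simp add: power2_eq_square algebra_simps)
      also have "\<dots> \<le> norm (x - y) * (2 * norm y)"
        using that r norm_triangle_ineq3[of x y] by (intro mult_mono) auto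
      finally show "norm (of_real ((norm y)\<^sup>2 - r\<^sup>2) :: complex) \<le> 2 * norm (x - y) * norm y" by simp
    qed (use y r in \<open>auto simp: norm_mult simp del: complex_cnj_diff\<close>)
    also have "\<dots> = 3 / r\<^sup>2 * norm (x - y)" using y r by (simp add: field_simps)
    finally show ?thesis .
  qed
  consider "norm x < r" "norm y < r" | "norm x < r" "norm y \<ge> r" | "norm x \<ge> r" "norm y < r" | "norm x \<ge> r" "norm y \<ge> r"
    by linarith
  then show ?thesis
  proof cases
    case 1
    have "norm (cnj x / r\<^sup>2 - cnj y / r\<^sup>2) = norm (cnj (x - y)) / r\<^sup>2"
      using r by (simp add: norm_divide norm_power flip: diff_divide_distrib complex_cnj_diff)
    also have "\<dots> \<le> 3 / r\<^sup>2 * norm (x - y)" by (simp add: divide_right_mono del: complex_cnj_diff)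
    finally show ?thesis using 1 by (simp add: trunc_kernel_def)
  next
    case 2 then show ?thesis using mixed[of x y] by (simp add: trunc_kernel_def)
  next
    case 3 then show ?thesis using mixed[of y x] by (simp add: trunc_kernel_def norm_minus_commute)
  next
    case 4
    have nz: "x \<noteq> 0" "y \<noteq> 0" using 4 r by auto
    have "norm (1 / x - 1 / y) = norm (x - y) / (norm x * norm y)"
      using nz by (simp add: diff_divide_eq_iff divide_diff_eq_iff norm_divide norm_mult norm_minus_commute)
    also have "\<dots> \<le> norm (x - y) / (r * r)"
      using 4 r nz by (intro divide_left_mono mult_mono mult_pos_pos) auto
    also have "\<dots> \<le> 3 / r\<^sup>2 * norm (x - y)" using r by (simp add: power2_eq_square divide_right_mono)
    finally show ?thesis using 4 by (simp add: trunc_kernel_def)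
  qed
qed

text \<open>Uniformity in \<open>r\<close> makes this the majorant when the truncation radii go to
  their limits.\<close>

lemma trunc_kernel_norm_le:
  assumes r: "r > 0"
  shows "norm (trunc_kernel r z) \<le> 1 / norm z"
proof (cases "z = 0")
  case True then show ?thesis using r by (simp add: trunc_kernel_def)
next
  case False
  have "norm z * norm z \<le> r * r" if "norm z < r" using that r by (intro mult_mono) auto
  then show ?thesis using False r
    by (auto simp: trunc_kernel_def norm_divide norm_mult norm_power power2_eq_square divide_simps)
qed

text \<open>The excluded circle, along which the branches meet in a corner, is a null set. This is
  why the vanishing of integrals of derivatives is stated with an almost everywhere limit.\<close>

lemma trunc_kernel_has_derivative:
  assumes r: "r > 0" and z: "norm z \<noteq> r"
  shows "(trunc_kernel r has_derivative (\<lambda>v. trunc_kernel_deriv r v z)) (at z)"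
proof (cases "norm z < r")
  case True
  have "((\<lambda>z. cnj z / r\<^sup>2) has_derivative (\<lambda>v. trunc_kernel_deriv r v z)) (at z)"
  proof -
    have "((\<lambda>z. cnj z / complex_of_real (r\<^sup>2)) has_derivative (\<lambda>v. cnj v / complex_of_real (r\<^sup>2))) (at z)"
      by (intro bounded_linear.has_derivative[OF bounded_linear_divide] bounded_linear.has_derivative[OF bounded_linear_cnj] has_derivative_ident)
    then show ?thesis using True by (simp add: trunc_kernel_deriv_def)
  qed
  then show ?thesis
    by (rule has_derivative_transform_within_open[where s="ball 0 r"])
      (use True in \<open>auto simp: trunc_kernel_def\<close>)
next
  case False
  then have "z \<noteq> 0" using r by auto
  then have "((\<lambda>z. 1 / z) has_derivative (\<lambda>v. trunc_kernel_deriv r v z)) (at z)"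
    using False by (auto simp: trunc_kernel_deriv_def power2_eq_square field_simps intro!: derivative_eq_intros)
  then show ?thesis
    by (rule has_derivative_transform_within_open[where s="- cball 0 r"])
      (use False z in \<open>auto simp: trunc_kernel_def\<close>)
qed

lemma trunc_kernel_measurable [measurable]:
  "trunc_kernel r \<in> borel_measurable borel" "trunc_kernel_deriv r v \<in> borel_measurable borel"
proof -
  have [measurable]: "cnj \<in> borel_measurable borel"
    by (intro borel_measurable_continuous_onI continuous_intros)
  have [measurable]: "(\<lambda>z::complex. c / z) \<in> borel_measurable borel" for c
    by (intro borel_measurable_divide) auto
  have [measurable]: "(\<lambda>z::complex. c / z\<^sup>2) \<in> borel_measurable borel" for c
    by (intro borel_measurable_divide) auto
  have b: "{z::complex. norm z < r} \<inter> space borel \<in> sets borel"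
    by (intro sets.Int borel_open open_Collect_less continuous_intros) auto
  show "trunc_kernel r \<in> borel_measurable borel"
    unfolding trunc_kernel_def[abs_def]
    by (intro measurable_If borel_measurable_divide) (use b in \<open>auto simp: Int_def conj_commute\<close>)
  show "trunc_kernel_deriv r v \<in> borel_measurable borel"
    unfolding trunc_kernel_deriv_def[abs_def]
    by (intro measurable_If borel_measurable_divide) (use b in \<open>auto simp: Int_def conj_commute\<close>)
qed

text \<open>Puts a Frechet derivative into the form of the limit hypothesis of
  \<open>integral_dir_derivative_eq_0\<close>.\<close>

lemma has_derivative_sequential:
  fixes h :: "complex \<Rightarrow> complex"
  assumes h: "(h has_derivative h') (at x)"
  shows "(\<lambda>n. of_nat (Suc n) * (h (v / of_nat (Suc n) + x) - h x)) \<longlonglongrightarrow> h' v"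
proof (cases "v = 0")
  case True
  then show ?thesis using has_derivative_linear[OF h] by (simp add: linear_0)
next
  case False
  define d where "d n = v / of_nat (Suc n)" for n
  have d0: "d n \<noteq> 0" for n using False by (simp add: d_def del: of_nat_Suc)
  have "d \<longlonglongrightarrow> 0" unfolding d_def using LIMSEQ_Suc[OF lim_const_over_n[of v]] by simp
  then have "filterlim d (at 0) sequentially" using d0 by (simp add: filterlim_at)
  moreover have "((\<lambda>k. norm (h (x + k) - h x - h' k) / norm k) \<longlongrightarrow> 0) (at 0)"
    using h by (simp add: has_derivative_at)
  ultimately have "(\<lambda>n. norm (h (x + d n) - h x - h' (d n)) / norm (d n)) \<longlonglongrightarrow> 0"
    by (rule filterlim_compose[rotated])
  then have "(\<lambda>n. norm (h (x + d n) - h x - h' (d n)) / norm (d n) * norm v) \<longlonglongrightarrow> 0"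
    using tendsto_mult_left_zero by blast
  also have "(\<lambda>n. norm (h (x + d n) - h x - h' (d n)) / norm (d n) * norm v)
     = (\<lambda>n. norm (of_nat (Suc n) * (h (v / of_nat (Suc n) + x) - h x) - h' v))"
  proof
    fix n
    have "d n = (1 / real (Suc n)) *\<^sub>R v" by (simp add: d_def scaleR_conv_of_real del: of_nat_Suc)
    then have "h' (d n) = (1 / real (Suc n)) *\<^sub>R h' v"
      using has_derivative_linear[OF h] linear_scale by metis
    then have "h' (d n) = h' v / of_nat (Suc n)" by (simp add: scaleR_conv_of_real del: of_nat_Suc)
    then have "of_nat (Suc n) * (h (x + d n) - h x) - h' v = of_nat (Suc n) * (h (x + d n) - h x - h' (d n))"
      by (simp add: field_simps del: of_nat_Suc)
    then show "norm (h (x + d n) - h x - h' (d n)) / norm (d n) * norm v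
       = norm (of_nat (Suc n) * (h (v / of_nat (Suc n) + x) - h x) - h' v)"
      using False by (simp add: d_def norm_mult norm_divide add.commute del: of_nat_Suc)
  qed
  finally show ?thesis by (simp add: tendsto_norm_zero_iff LIM_zero_iff)
qed

definition wirtinger_bar :: "(complex \<Rightarrow> complex) \<Rightarrow> complex \<Rightarrow> complex" where
  "wirtinger_bar g z = (dir_deriv 1 g z + \<i> * dir_deriv \<i> g z) / 2"

lemma frechet_derivative_complex_decomp:
  fixes g :: "complex \<Rightarrow> complex"
  assumes "g differentiable (at z)"
  shows "frechet_derivative g (at z) v = Re v *\<^sub>R dir_deriv 1 g z + Im v *\<^sub>R dir_deriv \<i> g z"
proof -
  have lin: "linear (frechet_derivative g (at z))" using assms by (rule linear_frechet_derivative)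
  have "v = Re v *\<^sub>R 1 + Im v *\<^sub>R \<i>" by (simp add: complex_eq_iff)
  then have "frechet_derivative g (at z) v = frechet_derivative g (at z) (Re v *\<^sub>R 1 + Im v *\<^sub>R \<i>)" by simp
  then show ?thesis unfolding dir_deriv_def linear_add[OF lin] linear_scale[OF lin] .
qed

text \<open>The mean value inequality on the convex compact disc, with the derivative bounded
  through its values in the directions \<open>1\<close> and \<open>\<i>\<close>. A C1 function need
  not be Lipschitz on the whole plane, so the constant depends on the disc.\<close>

lemma C1_on_lipschitz_cball:
  fixes g :: "complex \<Rightarrow> complex"
  assumes C1: "C1_on UNIV g"
  obtains M where "M \<ge> 0" "\<And>x y. x \<in> cball 0 R \<Longrightarrow> y \<in> cball 0 R \<Longrightarrow> norm (g x - g y) \<le> M * norm (x - y)"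
proof -
  have cont: "continuous_on (cball 0 R) (dir_deriv v g)" for v
    using C1 continuous_on_subset unfolding C1_on_def by blast
  have "\<exists>K. \<forall>z\<in>cball 0 R. norm (dir_deriv v g z) \<le> K" for v
    using compact_imp_bounded[OF compact_continuous_image[OF cont compact_cball]] by (auto simp: bounded_iff)
  then obtain K where K: "\<And>v z. z \<in> cball 0 R \<Longrightarrow> norm (dir_deriv v g z) \<le> K v" by metis
  define M where "M = \<bar>K 1\<bar> + \<bar>K \<i>\<bar>"
  have "norm (g x - g y) \<le> M * norm (x - y)" if "x \<in> cball 0 R" "y \<in> cball 0 R" for x y
  proof (rule differentiable_bound[where S="cball 0 R" and f'="\<lambda>z. frechet_derivative g (at z)"])
    fix z assume z: "z \<in> cball (0::complex) R"
    have d: "g differentiable (at z)" using C1 by (auto simp: C1_on_def)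
    then show "(g has_derivative frechet_derivative g (at z)) (at z within cball 0 R)"
      using frechet_derivative_works has_derivative_at_withinI by blast
    show "onorm (frechet_derivative g (at z)) \<le> M"
    proof (rule onorm_bound)
      fix v
      have "norm (frechet_derivative g (at z) v) \<le> \<bar>Re v\<bar> * norm (dir_deriv 1 g z) + \<bar>Im v\<bar> * norm (dir_deriv \<i> g z)"
        unfolding frechet_derivative_complex_decomp[OF d] by (rule order_trans[OF norm_triangle_ineq]) simp
      also have "\<dots> \<le> norm v * \<bar>K 1\<bar> + norm v * \<bar>K \<i>\<bar>"
        using K[OF z, of 1] K[OF z, of \<i>] abs_Re_le_cmod[of v] abs_Im_le_cmod[of v]
        by (intro add_mono mult_mono) auto
      finally show "norm (frechet_derivative g (at z) v) \<le> M * norm v" by (simp add: M_def algebra_simps)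
    qed (simp add: M_def)
  qed (use that in auto)
  then show thesis using that[of M] by (simp add: M_def)
qed

text \<open>The integrand is, almost everywhere, the conjugate derivative of the product of
  \<open>g\<close> and \<open>k\<close>, with \<open>d\<close> the conjugate derivative of
  \<open>k\<close>. This product is Lipschitz with compact support, so its derivatives in the
  directions \<open>1\<close> and \<open>\<i>\<close> integrate to 0; this replaces Stokes'
  theorem.\<close>

lemma integral_wirtinger_trunc_kernel:
  fixes g :: "complex \<Rightarrow> complex"
  assumes C1: "C1_on UNIV g" and r: "0 < r" and s: "0 < s"
  defines "k \<equiv> \<lambda>z. trunc_kernel r z - trunc_kernel s z"
    and "d \<equiv> \<lambda>z. (indicator (ball 0 r) z / of_real (r\<^sup>2) - indicator (ball 0 s) z / of_real (s\<^sup>2) :: complex)"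
  shows "integrable lborel (\<lambda>z. wirtinger_bar g z * k z + g z * d z)"
    "(LINT z|lborel. wirtinger_bar g z * k z + g z * d z) = 0"
proof -
  have diff: "g differentiable (at z)" for z using C1 by (auto simp: C1_on_def)
  have contg: "continuous_on A g" for A
    using diff by (meson differentiable_imp_continuous_within continuous_at_imp_continuous_on)
  have [measurable]: "g \<in> borel_measurable borel" by (rule borel_measurable_continuous_onI) (rule contg)
  have [measurable]: "dir_deriv v g \<in> borel_measurable borel" for v
    using C1 by (intro borel_measurable_continuous_onI) (auto simp: C1_on_def)
  define R where "R = max r s"
  obtain M where M: "M \<ge> 0" "\<And>x y. x \<in> cball 0 R \<Longrightarrow> y \<in> cball 0 R \<Longrightarrow> norm (g x - g y) \<le> M * norm (x - y)"
    using C1_on_lipschitz_cball[OF C1] by metis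
  obtain N where N: "\<And>z. z \<in> cball 0 R \<Longrightarrow> norm (g z) \<le> N"
    using compact_imp_bounded[OF compact_continuous_image[OF contg compact_cball[of 0 R]]]
      unfolding bounded_iff by blast
  have "N \<ge> 0" using order_trans[OF norm_ge_zero N[of 0]] r by (simp add: R_def)
  define L where "L = 3 / r\<^sup>2 + 3 / s\<^sup>2"
  have "L \<ge> 0" by (simp add: L_def)
  have kL: "norm (k x - k y) \<le> L * norm (x - y)" for x y
  proof -
    have "norm (k x - k y) \<le> norm (trunc_kernel r x - trunc_kernel r y) + norm (trunc_kernel s x - trunc_kernel s y)"
      unfolding k_def by (rule order_trans[OF _ norm_triangle_ineq4]) (simp add: algebra_simps)
    also have "\<dots> \<le> L * norm (x - y)"
      using trunc_kernel_lipschitz[OF r, of x y] trunc_kernel_lipschitz[OF s, of x y] by (simp add: L_def algebra_simps)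
    finally show ?thesis .
  qed
  \<comment> \<open>Beyond both radii the two truncations equal \<open>1 / x\<close> and
    cancel.\<close>
  have k0: "k x = 0" if "norm x \<ge> R" for x using that by (auto simp: k_def R_def trunc_kernel_def)
  have kb: "norm (k x) \<le> L * (2 * R)" if "norm x \<le> R" for x
  proof -
    have R: "norm (complex_of_real R) = R" using r by (simp add: R_def)
    have "norm (k x) \<le> L * norm (x - of_real R)" using kL[of x "of_real R"] k0[of "of_real R"] R by simp
    also have "norm (x - of_real R) \<le> 2 * R" using norm_triangle_ineq4[of x "of_real R"] R that by linarith
    finally show ?thesis using \<open>L \<ge> 0\<close> by (simp add: mult_left_mono)
  qed
  have "R > 0" using r by (simp add: R_def)
  have lip: "norm (g x * k x - g y * k y) \<le> (N * L + M * (L * (2 * R))) * norm (x - y)" for x y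
  proof -
    have nn: "0 \<le> M * (L * (2 * R)) * norm (x - y)" "0 \<le> N * (L * norm (x - y))"
      using M \<open>L \<ge> 0\<close> \<open>R > 0\<close> \<open>N \<ge> 0\<close> by auto
    \<comment> \<open>A Lipschitz bound for \<open>g\<close> is available on the disc only. If
      \<open>y\<close> lies outside, \<open>k y = 0\<close>, so the value of \<open>g\<close> at
      \<open>y\<close> does not matter and the difference is
      \<open>g x * (k x - k y)\<close>.\<close>
    have one: "norm (g x * k x - g y * k y) \<le> N * (L * norm (x - y))" if "norm x \<le> R" "norm y > R" for x y
    proof -
      have "norm (g x * k x - g y * k y) = norm (g x) * norm (k x - k y)" using that k0[of y] by (simp add: norm_mult)
      also have "\<dots> \<le> N * (L * norm (x - y))" using N[of x] that \<open>N \<ge> 0\<close> by (intro mult_mono kL) auto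
      finally show ?thesis .
    qed
    consider "norm x \<le> R" "norm y \<le> R" | "norm x \<le> R" "norm y > R" | "norm x > R" "norm y \<le> R" | "norm x > R" "norm y > R"
      by linarith
    then show ?thesis
    proof cases
      case 1
      have "g x * k x - g y * k y = g x * (k x - k y) + (g x - g y) * k y" by (simp add: algebra_simps)
      then have "norm (g x * k x - g y * k y) \<le> norm (g x) * norm (k x - k y) + norm (g x - g y) * norm (k y)"
        by (metis norm_mult norm_triangle_ineq)
      also have "\<dots> \<le> N * (L * norm (x - y)) + (M * norm (x - y)) * (L * (2 * R))"
        using 1 N[of x] \<open>N \<ge> 0\<close> M by (intro add_mono mult_mono kL kb) auto
      finally show ?thesis by (simp add: algebra_simps)
    next
      case 2 then show ?thesis using one[of x y] nn by (simp add: algebra_simps)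
    next
      case 3 then show ?thesis using one[of y x] nn by (simp add: algebra_simps norm_minus_commute)
    next
      case 4 then show ?thesis using nn by (simp add: k0 algebra_simps)
    qed
  qed
  define f where "f v z = dir_deriv v g z * k z + g z * (trunc_kernel_deriv r v z - trunc_kernel_deriv s v z)" for v z
  have f: "integrable lborel (f v)" "(LINT z|lborel. f v z) = 0" for v
  proof -
    have null: "sphere 0 t \<in> null_sets (lborel :: complex measure)" for t
      using negligible_sphere[of 0 t] by (auto simp: null_sets_completion_iff negligible_iff_null_sets)
    have ae: "AE z in lborel. norm (z::complex) \<noteq> t" for t
      using AE_not_in[OF null[of t]] by (simp add: dist_norm)
    have lim: "AE z in lborel. (\<lambda>n. of_nat (Suc n) * (g (v / of_nat (Suc n) + z) * k (v / of_nat (Suc n) + z) - g z * k z)) \<longlonglongrightarrow> f v z"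
      using ae[of r] ae[of s]
    proof eventually_elim
      case (elim z)
      have "(k has_derivative (\<lambda>v. trunc_kernel_deriv r v z - trunc_kernel_deriv s v z)) (at z)"
        unfolding k_def using elim r s by (intro has_derivative_diff trunc_kernel_has_derivative)
      moreover have "(g has_derivative (\<lambda>v. dir_deriv v g z)) (at z)"
        using diff frechet_derivative_works unfolding dir_deriv_def by blast
      ultimately have "((\<lambda>z. g z * k z) has_derivative
        (\<lambda>v. g z * (trunc_kernel_deriv r v z - trunc_kernel_deriv s v z) + dir_deriv v g z * k z)) (at z)"
        by (rule has_derivative_mult[rotated])
      from has_derivative_sequential[OF this, of v] show ?case by (simp add: f_def add.commute)
    qed
    have [measurable]: "f v \<in> borel_measurable lborel" unfolding f_def k_def by measurable
    show "integrable lborel (f v)" "(LINT z|lborel. f v z) = 0"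
      by (rule integral_dir_derivative_eq_0[OF lip _ lim, of R]; use k0 in force)+
  qed
  have eq: "(\<lambda>z. (f 1 z + \<i> * f \<i> z) / 2) = (\<lambda>z. wirtinger_bar g z * k z + g z * d z)"
  proof
    fix z
    have *: "(trunc_kernel_deriv t 1 z + \<i> * trunc_kernel_deriv t \<i> z) / 2 = indicator (ball 0 t) z / of_real (t\<^sup>2)" for t
      by (auto simp: trunc_kernel_deriv_def indicator_def field_simps)
    have "(f 1 z + \<i> * f \<i> z) / 2 = wirtinger_bar g z * k z
      + g z * ((trunc_kernel_deriv r 1 z + \<i> * trunc_kernel_deriv r \<i> z) / 2 - (trunc_kernel_deriv s 1 z + \<i> * trunc_kernel_deriv s \<i> z) / 2)"
      by (simp add: f_def wirtinger_bar_def field_simps)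
    then show "(f 1 z + \<i> * f \<i> z) / 2 = wirtinger_bar g z * k z + g z * d z" unfolding * d_def .
  qed
  have "integrable lborel (\<lambda>z. (f 1 z + \<i> * f \<i> z) / 2)" using f by auto
  then show "integrable lborel (\<lambda>z. wirtinger_bar g z * k z + g z * d z)" unfolding eq .
  have "(LINT z|lborel. (f 1 z + \<i> * f \<i> z) / 2) = 0" using f by simp
  then show "(LINT z|lborel. wirtinger_bar g z * k z + g z * d z) = 0" unfolding eq .
qed

text \<open>With an inner and an outer truncation radius, the integral of the conjugate derivative
  against \<open>k n\<close> is the outer mean minus the inner mean. The outer mean tends to 0
  because \<open>g\<close> vanishes at infinity, the inner one to \<open>pi * g 0\<close>, and
  \<open>k n\<close> tends to \<open>1 / z\<close> under the majorant
  \<open>2 / norm z\<close>.\<close>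

theorem Cauchy_Pompeiu_plane:
  fixes g :: "complex \<Rightarrow> complex"
  assumes C1: "C1_on UNIV g" and lim: "(g \<longlongrightarrow> 0) at_infinity"
    and int: "integrable lborel (\<lambda>z. wirtinger_bar g z / z)"
  shows "(LINT z|lborel. wirtinger_bar g z / z) = - pi * g 0"
proof -
  have diff: "g differentiable (at z)" for z using C1 by (auto simp: C1_on_def)
  have contg: "continuous_on A g" for A
    using diff by (meson differentiable_imp_continuous_within continuous_at_imp_continuous_on)
  have gm[measurable]: "g \<in> borel_measurable borel" by (rule borel_measurable_continuous_onI) (rule contg)
  have [measurable]: "dir_deriv v g \<in> borel_measurable borel" for v
    using C1 by (intro borel_measurable_continuous_onI) (auto simp: C1_on_def)
  have wm[measurable]: "wirtinger_bar g \<in> borel_measurable borel" unfolding wirtinger_bar_def[abs_def] by measurable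
  obtain N where N: "\<And>z. norm (g z) \<le> N"
  proof -
    obtain R where R: "\<And>z. norm z \<ge> R \<Longrightarrow> norm (g z) < 1"
      using lim unfolding tendsto_iff eventually_at_infinity by (metis dist_0_norm dist_commute zero_less_one)
    obtain K where "\<And>z. z \<in> cball 0 R \<Longrightarrow> norm (g z) \<le> K"
      using compact_imp_bounded[OF compact_continuous_image[OF contg compact_cball[of 0 R]]]
      unfolding bounded_iff by blast
    then have "norm (g z) \<le> max K 1" for z using R[of z] by (cases "norm z \<ge> R") (auto simp: less_imp_le intro: max.coboundedI1 max.coboundedI2)
    then show thesis using that by blast
  qed
  \<comment> \<open>The integral over the disc of radius \<open>t\<close>, divided by
    \<open>t\<^sup>2\<close>, is rescaled to the fixed unit disc so that dominated convergence
    applies in \<open>t\<close>. It is not divided by the area, hence the factor \<open>pi\<close>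
    at the end.\<close>
  define A where "A t = (LINT z|lborel. indicator (ball 0 1) z * g (of_real t * z))" for t :: real
  have indint: "integrable lborel (\<lambda>z::complex. indicator (ball 0 t) z :: real)" for t
    by (intro integrable_real_indicator emeasure_lborel_ball_finite) auto
  have gind: "integrable lborel (\<lambda>z. g z * indicator (ball 0 t) z)" for t
    by (rule Bochner_Integration.integrable_bound[OF integrable_mult_right[OF indint[of t], of N]])
      (use N in \<open>auto simp: indicator_def intro!: AE_I2 order_trans[OF _ abs_ge_self]\<close>)
  have avg: "(LINT z|lborel. g z * indicator (ball 0 t) z) / of_real (t\<^sup>2) = A t" if t: "t > 0" for t
  proof -
    have "(\<lambda>z. g z * indicator (ball 0 t) z) \<in> borel_measurable borel"
      using borel_measurable_integrable[OF gind[of t]] by simp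
    then have "(LINT z|lborel. g z * indicator (ball 0 t) z)
      = (complex_of_real t)\<^sup>2 * (LINT z|lborel. g (of_real t * z) * indicator (ball 0 t) (of_real t * z))"
      using lborel_integral_scale_complex[of "\<lambda>z. g z * indicator (ball 0 t) z" t] t by simp
    also have "(\<lambda>z. g (of_real t * z) * indicator (ball 0 t) (of_real t * z)) = (\<lambda>z. indicator (ball 0 1) z * g (of_real t * z))"
      using t by (auto simp: indicator_def norm_mult fun_eq_iff)
    finally show ?thesis using t by (simp add: A_def)
  qed
  define r where "r n = 1 / real (Suc n)" for n
  define s where "s n = real (Suc n)" for n
  have rs: "r n > 0" "s n > 0" for n by (auto simp: r_def s_def)
  define k where "k n z = trunc_kernel (r n) z - trunc_kernel (s n) z" for n z
  have r0: "r \<longlonglongrightarrow> 0" unfolding r_def using LIMSEQ_Suc[OF lim_const_over_n[of "1::real"]] by simp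
  have sinf: "filterlim s at_top sequentially" unfolding s_def
    using filterlim_Suc filterlim_compose filterlim_real_sequentially by blast
  have bound: "norm (wirtinger_bar g z * k n z) \<le> 2 * norm (wirtinger_bar g z / z)" for n z
  proof -
    have "norm (k n z) \<le> 2 / norm z"
      unfolding k_def using norm_triangle_ineq4[of "trunc_kernel (r n) z" "trunc_kernel (s n) z"]
        trunc_kernel_norm_le[OF rs(1), of n z] trunc_kernel_norm_le[OF rs(2), of n z] by simp
    then have "norm (wirtinger_bar g z) * norm (k n z) \<le> norm (wirtinger_bar g z) * (2 / norm z)"
      by (intro mult_left_mono) auto
    then show ?thesis by (simp add: norm_mult norm_divide mult.commute)
  qed
  have lhs_int: "integrable lborel (\<lambda>z. wirtinger_bar g z * k n z)" for n
  proof (rule Bochner_Integration.integrable_bound)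
    show "integrable lborel (\<lambda>z. 2 * norm (wirtinger_bar g z / z))" using int by simp
    show "(\<lambda>z. wirtinger_bar g z * k n z) \<in> borel_measurable lborel" unfolding k_def by measurable
  qed (use bound in auto)
  have eq: "(LINT z|lborel. wirtinger_bar g z * k n z) = A (s n) - A (r n)" for n
  proof -
    have i: "integrable lborel (\<lambda>z. g z * (indicator (ball 0 (r n)) z / of_real ((r n)\<^sup>2)))"
            "integrable lborel (\<lambda>z. g z * (indicator (ball 0 (s n)) z / of_real ((s n)\<^sup>2)))"
      using gind[of "r n"] gind[of "s n"] by (auto simp: times_divide_eq_right)
    have "(LINT z|lborel. wirtinger_bar g z * k n z) + ((LINT z|lborel. g z * (indicator (ball 0 (r n)) z / of_real ((r n)\<^sup>2)))
        - (LINT z|lborel. g z * (indicator (ball 0 (s n)) z / of_real ((s n)\<^sup>2))))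
      = (LINT z|lborel. wirtinger_bar g z * k n z + g z * (indicator (ball 0 (r n)) z / of_real ((r n)\<^sup>2) - indicator (ball 0 (s n)) z / of_real ((s n)\<^sup>2)))"
      unfolding right_diff_distrib using i lhs_int by simp
    also have "\<dots> = 0" unfolding k_def by (rule integral_wirtinger_trunc_kernel(2)[OF C1 rs])
    finally show ?thesis using avg[OF rs(1)[of n]] avg[OF rs(2)[of n]] by (simp add: algebra_simps)
  qed
  have L1: "(\<lambda>n. LINT z|lborel. wirtinger_bar g z * k n z) \<longlonglongrightarrow> (LINT z|lborel. wirtinger_bar g z / z)"
  proof (rule integral_dominated_convergence)
    show "integrable lborel (\<lambda>z. 2 * norm (wirtinger_bar g z / z))" using int by simp
    show "AE z in lborel. (\<lambda>n. wirtinger_bar g z * k n z) \<longlonglongrightarrow> wirtinger_bar g z / z"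
    proof (rule AE_I2)
      fix z :: complex
      show "(\<lambda>n. wirtinger_bar g z * k n z) \<longlonglongrightarrow> wirtinger_bar g z / z"
      proof (cases "z = 0")
        case True
        \<comment> \<open>At the origin both sides are 0: the truncated kernels vanish there and
          division by 0 yields 0.\<close>
        then show ?thesis using rs by (simp add: k_def trunc_kernel_def)
      next
        case False
        \<comment> \<open>Once \<open>r n < norm z < s n\<close>, the inner kernel is
          \<open>1 / z\<close> and the outer one is \<open>cnj z / (s n)\<^sup>2\<close>. The radii
          were chosen reciprocal, so the latter is \<open>cnj z * (r n)\<^sup>2\<close>.\<close>
        have e: "\<forall>\<^sub>F n in sequentially. 1 / z - cnj z * of_real ((r n)\<^sup>2) = k n z"
        proof -
          have "\<forall>\<^sub>F n in sequentially. r n < norm z" using order_tendstoD(2)[OF r0] False by simp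
          moreover have "\<forall>\<^sub>F n in sequentially. s n > norm z" using sinf by (simp add: filterlim_at_top_dense)
          ultimately show ?thesis
          proof eventually_elim
            case (elim n) then show ?case
              by (simp add: k_def trunc_kernel_def r_def s_def divide_simps)
          qed
        qed
        have "(\<lambda>n. 1 / z - cnj z * of_real ((r n)\<^sup>2)) \<longlonglongrightarrow> 1 / z - cnj z * of_real (0\<^sup>2)"
          by (intro tendsto_intros r0)
        then have "(\<lambda>n. k n z) \<longlonglongrightarrow> 1 / z" using tendsto_cong[OF e] by simp
        then have "(\<lambda>n. wirtinger_bar g z * k n z) \<longlonglongrightarrow> wirtinger_bar g z * (1 / z)" by (rule tendsto_mult_left)
        then show ?thesis by simp
      qed
    qed
    show "(\<lambda>z. wirtinger_bar g z * k n z) \<in> borel_measurable lborel" for n unfolding k_def by measurable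
  qed (use bound in auto)
  have Nb: "norm (indicator (ball 0 1) z * g (of_real t * z)) \<le> N * indicator (ball 0 1) z" for z :: complex and t
    using N by (auto simp: indicator_def)
  have [measurable]: "ball (0::complex) 1 \<in> sets borel" by auto
  have meas: "(\<lambda>z. indicator (ball 0 1) z * g (of_real t * z)) \<in> borel_measurable borel"
    "(\<lambda>z. indicator (ball (0::complex) 1) z * g 0) \<in> borel_measurable borel" for t
    by measurable
  have L2: "(\<lambda>n. A (r n)) \<longlonglongrightarrow> (LINT z|lborel. indicator (ball (0::complex) 1) z * g 0)"
    unfolding A_def
  proof (rule integral_dominated_convergence[where w="\<lambda>z::complex. N * indicator (ball 0 1) z"])
    show "integrable lborel (\<lambda>z::complex. N * indicator (ball 0 1) z)" using indint[of 1] by simp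
    have "(\<lambda>n. g (of_real (r n) * z)) \<longlonglongrightarrow> g (of_real 0 * z)" for z
    proof (rule isCont_tendsto_compose[where g=g])
      show "isCont g (of_real 0 * z)" using contg[of UNIV] by (simp add: continuous_on_eq_continuous_at)
      show "(\<lambda>n. of_real (r n) * z) \<longlonglongrightarrow> of_real 0 * z" by (intro tendsto_intros r0)
    qed
    then show "AE z in lborel. (\<lambda>n. indicator (ball 0 1) z * g (of_real (r n) * z)) \<longlonglongrightarrow> indicator (ball (0::complex) 1) z * g 0"
      by (auto intro!: tendsto_intros)
  qed (use Nb meas in auto)
  have L3: "(\<lambda>n. A (s n)) \<longlonglongrightarrow> (LINT z::complex|lborel. 0)"
    unfolding A_def
  proof (rule integral_dominated_convergence[where w="\<lambda>z::complex. N * indicator (ball 0 1) z"])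
    show "integrable lborel (\<lambda>z::complex. N * indicator (ball 0 1) z)" using indint[of 1] by simp
    have "(\<lambda>n. indicator (ball 0 1) z * g (of_real (s n) * z)) \<longlonglongrightarrow> 0" if "z \<noteq> 0" for z
    proof -
      have "filterlim (\<lambda>n. norm (of_real (s n) * z)) at_top sequentially"
        using sinf that rs(2) by (auto simp: norm_mult less_imp_le intro!: filterlim_at_top_mult_tendsto_pos[of _ "norm z"])
      then have "filterlim (\<lambda>n. of_real (s n) * z) at_infinity sequentially"
        by (simp add: filterlim_at_infinity_conv_norm_at_top)
      then have "(\<lambda>n. g (of_real (s n) * z)) \<longlonglongrightarrow> 0" using lim filterlim_compose by blast
      then show ?thesis using tendsto_mult_right_zero by blast
    qed
    \<comment> \<open>At the origin the integrand is constantly \<open>g 0\<close>, so this limit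
      holds only almost everywhere.\<close>
    moreover have "AE z::complex in lborel. z \<noteq> 0" using AE_lborel_singleton by fastforce
    ultimately show "AE z in lborel. (\<lambda>n. indicator (ball 0 1) z * g (of_real (s n) * z)) \<longlonglongrightarrow> 0" by auto
  qed (use Nb meas in auto)
  have "(\<lambda>n. A (s n) - A (r n)) \<longlonglongrightarrow> 0 - (LINT z|lborel. indicator (ball (0::complex) 1) z * g 0)"
    using tendsto_diff[OF L3 L2] by simp
  then have "(LINT z|lborel. wirtinger_bar g z / z) = 0 - (LINT z|lborel. indicator (ball (0::complex) 1) z * g 0)"
    using L1 unfolding eq by (rule LIMSEQ_unique[rotated])
  also have "(LINT z|lborel. indicator (ball (0::complex) 1) z * g 0) = (LINT z|lborel. indicator (ball (0::complex) 1) z *\<^sub>R g 0)"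
    by (intro Bochner_Integration.integral_cong) (auto simp: indicator_def)
  also have "\<dots> = measure lborel (ball (0::complex) 1) *\<^sub>R g 0"
    using emeasure_lborel_ball_finite[of "0::complex" 1] by (simp add: integral_indicator)
  also have "measure lborel (ball (0::complex) 1) = pi"
    using content_ball[of 1 "0::complex"] by (simp add: unit_ball_vol_2)
  finally show ?thesis by (simp add: scaleR_conv_of_real)
qed

section \<open>Integrals of the Cauchy kernel against decreasing weights\<close>

text \<open>What remains of the reciprocal fiber weight as a bound when all fiber coordinates but
  one are dropped.\<close>

definition radial_weight :: "real \<Rightarrow> real \<Rightarrow> real" where
  "radial_weight \<epsilon> t = 1 / (1 + t powr (1 + \<epsilon>))"

lemma radial_weight_nonneg: "0 \<le> radial_weight \<epsilon> t"
  by (simp add: radial_weight_def add_nonneg_nonneg)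

lemma radial_weight_le_1: "radial_weight \<epsilon> t \<le> 1"
  by (simp add: radial_weight_def divide_simps) (smt (verit) powr_ge_zero)

lemma radial_weight_antimono: "0 \<le> s \<Longrightarrow> s \<le> t \<Longrightarrow> \<epsilon> > 0 \<Longrightarrow> radial_weight \<epsilon> t \<le> radial_weight \<epsilon> s"
  unfolding radial_weight_def
  by (intro divide_left_mono add_left_mono powr_mono2 mult_pos_pos add_pos_nonneg) auto

lemma radial_weight_measurable [measurable]: "radial_weight \<epsilon> \<in> borel_measurable borel"
  unfolding radial_weight_def by measurable

lemma dyadic_interval:
  fixes x :: real assumes "1 \<le> x" obtains n :: nat where "2 ^ n \<le> x" "x < 2 ^ Suc n"
proof -
  obtain m where m: "x < 2 ^ m" using real_arch_pow[of 2 x] by auto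
  define k where "k = (LEAST m. x < 2 ^ m)"
  have k: "x < 2 ^ k" unfolding k_def by (rule LeastI) (rule m)
  have "k \<noteq> 0" using k assms by (cases k) auto
  then obtain n where n: "k = Suc n" by (cases k) auto
  have "\<not> x < 2 ^ n" using not_less_Least[of n "\<lambda>m. x < 2 ^ m"] n k_def by simp
  then show thesis using that[of n] k n by simp
qed

text \<open>A substitute for polar coordinates: the disc of radius \<open>r n\<close> has area
  \<open>pi * (r n)\<^sup>2\<close>, so the last hypothesis bounds the sum of the integrals by a
  geometric series.\<close>

lemma nn_integral_dyadic_finite:
  fixes c q :: real
  assumes "0 \<le> c" "\<And>n. 0 \<le> a n" "\<And>n. 0 \<le> r n" "0 \<le> q" "q < 1" "\<And>n. a n * (r n)\<^sup>2 \<le> c * q ^ n"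
  shows "(\<integral>\<^sup>+\<zeta>. (\<Sum>n. ennreal (a n) * indicator (cball (0::complex) (r n)) \<zeta>) \<partial>lborel) < \<infinity>"
proof -
  have "(\<integral>\<^sup>+\<zeta>. (\<Sum>n. ennreal (a n) * indicator (cball (0::complex) (r n)) \<zeta>) \<partial>lborel)
      = (\<Sum>n. \<integral>\<^sup>+\<zeta>. ennreal (a n) * indicator (cball (0::complex) (r n)) \<zeta> \<partial>lborel)"
    by (intro nn_integral_suminf) measurable
  also have "\<dots> = (\<Sum>n. ennreal (pi * (a n * (r n)\<^sup>2)))"
    using assms by (intro suminf_cong)
      (simp add: nn_integral_cmult emeasure_cball unit_ball_vol_2 ennreal_mult' [symmetric] mult_ac)
  also have "\<dots> \<le> (\<Sum>n. ennreal (pi * c * q ^ n))"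
    using assms by (intro suminf_le ennreal_leI) (auto simp: mult.assoc)
  also have "\<dots> = ennreal (\<Sum>n. pi * c * q ^ n)"
    using assms by (intro suminf_ennreal2) (auto intro!: summable_mult summable_geometric)
  finally show ?thesis by (simp add: order.strict_trans1)
qed

text \<open>Dyadic annuli. Near the origin, \<open>g1\<close> bounds \<open>1 / norm \<zeta>\<close>
  by \<open>2 * 2 ^ n\<close> on a disc of radius \<open>(1/2) ^ n\<close>, with ratio
  \<open>1/2\<close>. Far out, \<open>g2\<close> bounds the integrand by the power
  \<open>-(2 + \<epsilon>)\<close> of \<open>2 ^ n\<close> on a disc of area
  \<open>4 * pi * 4 ^ n\<close>, with ratio \<open>2 powr -\<epsilon>\<close>, which is below 1
  because \<open>\<epsilon> > 0\<close>.\<close>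

lemma integrable_radial_kernel:
  assumes "\<epsilon> > 0"
  shows "integrable lborel (\<lambda>\<zeta>::complex. 1 / norm \<zeta> * radial_weight \<epsilon> (norm \<zeta>))"
proof (rule integrableI_bounded)
  show "(\<lambda>\<zeta>::complex. 1 / norm \<zeta> * radial_weight \<epsilon> (norm \<zeta>)) \<in> borel_measurable lborel" by measurable
  define g1 where "g1 n \<zeta> = ennreal (2 * 2 ^ n) * indicator (cball (0::complex) ((1/2) ^ n)) \<zeta>" for n :: nat and \<zeta>
  define g2 where "g2 n \<zeta> = ennreal ((2 powr -(2 + \<epsilon>)) ^ n) * indicator (cball (0::complex) (2 * 2 ^ n)) \<zeta>" for n :: nat and \<zeta>
  have i1: "(\<integral>\<^sup>+\<zeta>. (\<Sum>n. g1 n \<zeta>) \<partial>lborel) < \<infinity>"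
    unfolding g1_def
    by (rule nn_integral_dyadic_finite[where c=2 and q="1/2"])
      (auto simp: power2_eq_square field_simps simp flip: power_mult_distrib)
  have i2: "(\<integral>\<^sup>+\<zeta>. (\<Sum>n. g2 n \<zeta>) \<partial>lborel) < \<infinity>"
    unfolding g2_def
  proof (rule nn_integral_dyadic_finite[where c=4 and q="2 powr -\<epsilon>"])
    fix n :: nat
    have "2 powr - \<epsilon> = 2 powr -(2+\<epsilon>) * 4"
      by (simp add: powr_diff powr_minus powr_add field_simps)
    then show "(2 powr - (2 + \<epsilon>)) ^ n * (2 * 2 ^ n)\<^sup>2 \<le> 4 * (2 powr - \<epsilon>) ^ n"
      by (simp add: power_mult_distrib power2_eq_square flip: power_mult_distrib[of 2 2])
  qed (use assms in \<open>auto simp: powr_less_one\<close>)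
  have le: "ennreal (norm (1 / norm \<zeta> * radial_weight \<epsilon> (norm \<zeta>))) \<le> (\<Sum>n. g1 n \<zeta>) + (\<Sum>n. g2 n \<zeta>)" for \<zeta> :: complex
  proof -
    have w: "0 \<le> radial_weight \<epsilon> (norm \<zeta>)" "radial_weight \<epsilon> (norm \<zeta>) \<le> 1"
      by (rule radial_weight_nonneg radial_weight_le_1)+
    consider "\<zeta> = 0" | "\<zeta> \<noteq> 0" "norm \<zeta> \<le> 1" | "norm \<zeta> \<ge> 1" by linarith
    then show ?thesis
    proof cases
      case 1 then show ?thesis by simp
    next
      case 2
      then obtain n where n: "2 ^ n \<le> 1 / norm \<zeta>" "1 / norm \<zeta> < 2 ^ Suc n"
        using dyadic_interval[of "1 / norm \<zeta>"] by (auto simp: field_simps)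
      have "norm (1 / norm \<zeta> * radial_weight \<epsilon> (norm \<zeta>)) \<le> 1 / norm \<zeta>"
        using w by (simp add: mult_left_le divide_right_mono)
      also have "\<dots> \<le> 2 * 2 ^ n" using n by simp
      finally have "ennreal (norm (1 / norm \<zeta> * radial_weight \<epsilon> (norm \<zeta>))) \<le> g1 n \<zeta>"
        using n 2 by (auto simp: g1_def indicator_def field_simps intro!: ennreal_leI)
      also have "\<dots> \<le> (\<Sum>n. g1 n \<zeta>)"
        using sum_le_suminf[of "\<lambda>n. g1 n \<zeta>" "{n}"] by (simp add: summableI)
      finally show ?thesis by (simp add: add_increasing2)
    next
      case 3
      then obtain n where n: "2 ^ n \<le> norm \<zeta>" "norm \<zeta> < 2 ^ Suc n"
        using dyadic_interval[of "norm \<zeta>"] by auto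
      have "norm (1 / norm \<zeta> * radial_weight \<epsilon> (norm \<zeta>)) = 1 / (norm \<zeta> * (1 + norm \<zeta> powr (1 + \<epsilon>)))"
        by (simp add: radial_weight_def add_nonneg_nonneg)
      also have "\<dots> \<le> 1 / (norm \<zeta> * norm \<zeta> powr (1 + \<epsilon>))"
        using 3 by (intro divide_left_mono mult_left_mono mult_pos_pos add_pos_nonneg) auto
      also have "\<dots> = norm \<zeta> powr -(2 + \<epsilon>)"
      proof -
        have "norm \<zeta> powr (2 + \<epsilon>) = norm \<zeta> powr 1 * norm \<zeta> powr (1 + \<epsilon>)"
          unfolding powr_add[symmetric] by (simp add: add_ac)
        moreover have "norm \<zeta> powr 1 = norm \<zeta>" using 3 by simp
        ultimately show ?thesis unfolding powr_minus by (simp add: divide_inverse)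
      qed
      also have "\<dots> \<le> (2 ^ n) powr -(2 + \<epsilon>)"
        using n assms by (intro powr_mono2') auto
      also have "\<dots> = (2 powr -(2 + \<epsilon>)) ^ n"
        by (simp add: powr_power powr_powr mult.commute flip: powr_realpow)
      finally have "ennreal (norm (1 / norm \<zeta> * radial_weight \<epsilon> (norm \<zeta>))) \<le> g2 n \<zeta>"
        using n by (auto simp: g2_def indicator_def intro!: ennreal_leI)
      also have "\<dots> \<le> (\<Sum>n. g2 n \<zeta>)"
        using sum_le_suminf[of "\<lambda>n. g2 n \<zeta>" "{n}"] by (simp add: summableI)
      finally show ?thesis by (simp add: add_increasing)
    qed
  qed
  have [measurable]: "(\<lambda>\<zeta>. \<Sum>n. g1 n \<zeta>) \<in> borel_measurable lborel" "(\<lambda>\<zeta>. \<Sum>n. g2 n \<zeta>) \<in> borel_measurable lborel"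
    unfolding g1_def g2_def by measurable
  have "(\<integral>\<^sup>+\<zeta>. ennreal (norm (1 / norm (\<zeta>::complex) * radial_weight \<epsilon> (norm \<zeta>))) \<partial>lborel)
     \<le> (\<integral>\<^sup>+\<zeta>. (\<Sum>n. g1 n \<zeta>) + (\<Sum>n. g2 n \<zeta>) \<partial>lborel)"
    by (intro nn_integral_mono le)
  also have "\<dots> < \<infinity>" using i1 i2 by (simp add: nn_integral_add)
  finally show "(\<integral>\<^sup>+\<zeta>. ennreal (norm (1 / norm (\<zeta>::complex) * radial_weight \<epsilon> (norm \<zeta>))) \<partial>lborel) < \<infinity>" .
qed

section \<open>Rotation invariance of Lebesgue measure and shifted kernels\<close>

lemma lborel_distr_orthogonal:
  fixes f :: "real^'n::{finite,wellorder} \<Rightarrow> real^'n::_"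
  assumes "orthogonal_transformation f"
  shows "distr lborel borel f = lborel"
proof -
  have lin: "linear f" and inv: "orthogonal_transformation (inv f)" "bij f"
    using assms by (auto simp: orthogonal_transformation_linear orthogonal_transformation_inv orthogonal_transformation_bij)
  have [measurable]: "f \<in> borel_measurable borel"
    using lin by (intro borel_measurable_continuous_onI linear_continuous_on linear_conv_bounded_linear[THEN iffD1])
  have "lborel = distr lborel borel f"
  proof (rule lborel_eqI)
    fix l u :: "real^'n::_" assume le: "\<And>b. b \<in> Basis \<Longrightarrow> l \<bullet> b \<le> u \<bullet> b"
    have vim: "f -` box l u = inv f ` box l u" using inv(2) by (simp add: bij_vimage_eq_inv_image)
    have [measurable]: "f -` box l u \<in> sets borel" by (rule measurable_sets_borel[of _ borel]) auto
    have m: "inv f ` box l u \<in> lmeasurable" "measure lebesgue (inv f ` box l u) = measure lebesgue (box l u)"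
      using measurable_orthogonal_image measure_orthogonal_image inv(1) lmeasurable_box by blast+
    have "emeasure (distr lborel borel f) (box l u) = emeasure lborel (f -` box l u)"
      by (simp add: emeasure_distr)
    also have "\<dots> = emeasure lebesgue (inv f ` box l u)"
      by (simp flip: vim)
    also have "\<dots> = ennreal (measure lebesgue (box l u))"
      using m emeasure_eq_measure2 by metis
    also have "\<dots> = (\<Prod>b\<in>Basis. (u - l) \<bullet> b)"
      using le by (simp add: measure_lborel_box_eq[simplified] inner_diff_left)
    finally show "emeasure (distr lborel borel f) (box l u) = (\<Prod>b\<in>Basis. (u - l) \<bullet> b)" .
  qed auto
  then show ?thesis by simp
qed

text \<open>In the real coordinates given by \<open>F\<close>, multiplication by \<open>c\<close> is
  an orthogonal map of the plane. The inverse \<open>G\<close> of \<open>F\<close> carries Lebesgue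
  measure to Lebesgue measure because it matches boxes with boxes.\<close>

lemma lborel_distr_isometry_complex:
  fixes c :: complex assumes "norm c = 1"
  shows "distr lborel borel (\<lambda>\<zeta>. c * \<zeta>) = lborel"
proof -
  define F :: "complex \<Rightarrow> real^2" where "F z = vector [Re z, Im z]" for z
  define G :: "real^2 \<Rightarrow> complex" where "G v = Complex (v $ 1) (v $ 2)" for v
  have GF: "G (F z) = z" and FG: "F (G v) = v" for z v
    by (auto simp: F_def G_def vec_eq_iff forall_2)
  have linF: "linear F" and linG: "linear G"
    by (auto intro!: linearI simp: F_def G_def vec_eq_iff forall_2 complex_eq_iff)
  have normF: "norm (F z) = norm z" for z
    by (simp add: F_def norm_vec_def L2_set_def sum_2 cmod_def)
  have normG: "norm (G v) = norm v" for v using normF[of "G v"] FG by simp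
  have [measurable]: "F \<in> borel_measurable borel" "G \<in> borel_measurable borel"
    using linF linG by (auto intro!: borel_measurable_continuous_onI linear_continuous_on simp flip: linear_conv_bounded_linear)
  have *: "lborel = distr lborel borel G"
  proof (rule lborel_eqI)
    fix l u :: complex assume le: "\<And>b. b \<in> Basis \<Longrightarrow> l \<bullet> b \<le> u \<bullet> b"
    have "Re l \<le> Re u" "Im l \<le> Im u" using le[of 1] le[of \<i>] by (auto simp: Basis_complex_def)
    have vim: "G -` box l u = box (F l) (F u)"
      by (auto simp: G_def F_def mem_box_cart forall_2 in_box_complex_iff)
    have "emeasure (distr lborel borel G) (box l u) = emeasure lborel (box (F l) (F u))"
      by (simp add: emeasure_distr vim)
    also have "\<dots> = (\<Prod>b\<in>Basis. (u - l) \<bullet> b)"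
      using \<open>Re l \<le> Re u\<close> \<open>Im l \<le> Im u\<close>
      by (subst emeasure_lborel_box) (auto simp: Basis_vec_def Basis_complex_def F_def UNIV_2 axis_eq_axis inner_axis complex_eq_iff
         prod.insert_remove)
    finally show "emeasure (distr lborel borel G) (box l u) = (\<Prod>b\<in>Basis. (u - l) \<bullet> b)" .
  qed auto
  have "orthogonal_transformation (\<lambda>v. F (c * G v))"
    unfolding orthogonal_transformation
    using linear_compose[OF linear_compose[OF linG], of "\<lambda>z. c * z" F] linF assms
    by (auto simp: o_def normF normG norm_mult linear_iff algebra_simps)
  then have R: "distr lborel borel (\<lambda>v. F (c * G v)) = lborel"
    by (rule lborel_distr_orthogonal)
  have "distr lborel borel (\<lambda>\<zeta>. c * \<zeta>) = distr (distr lborel borel G) borel (\<lambda>\<zeta>. c * \<zeta>)"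
    using * by simp
  also have "\<dots> = distr lborel borel (\<lambda>v. c * G v)"
    by (subst distr_distr) (auto simp: o_def)
  also have "\<dots> = distr (distr lborel borel (\<lambda>v. F (c * G v))) borel G"
    by (subst distr_distr) (auto simp: o_def GF)
  also have "\<dots> = lborel" using R * by simp
  finally show ?thesis .
qed

text \<open>If \<zeta> is the smaller of \<zeta> and \<open>a + \<zeta>\<close>, the weight grows
  when evaluated at \<zeta>; otherwise the kernel grows when evaluated at
  \<open>a + \<zeta>\<close>. The point \<open>a + \<zeta> = 0\<close> is excluded because
  \<open>1 / 0 = 0\<close> would annihilate the second summand there.\<close>

lemma cauchy_kernel_weight_split:
  assumes "\<epsilon> > 0" "a + \<zeta> \<noteq> 0"
  shows "1 / norm (\<zeta>::complex) * radial_weight \<epsilon> (norm (a + \<zeta>))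
    \<le> 1 / norm \<zeta> * radial_weight \<epsilon> (norm \<zeta>) + 1 / norm (a + \<zeta>) * radial_weight \<epsilon> (norm (a + \<zeta>))"
proof (cases "norm \<zeta> \<le> norm (a + \<zeta>)")
  case True
  then have "1 / norm \<zeta> * radial_weight \<epsilon> (norm (a + \<zeta>)) \<le> 1 / norm \<zeta> * radial_weight \<epsilon> (norm \<zeta>)"
    using assms by (intro mult_left_mono radial_weight_antimono) auto
  then show ?thesis by (simp add: radial_weight_nonneg add_increasing2)
next
  case False
  then have "1 / norm \<zeta> * radial_weight \<epsilon> (norm (a + \<zeta>)) \<le> 1 / norm (a + \<zeta>) * radial_weight \<epsilon> (norm (a + \<zeta>))"
    using assms by (intro mult_right_mono radial_weight_nonneg divide_left_mono mult_pos_pos) auto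
  then show ?thesis by (simp add: radial_weight_nonneg add_increasing)
qed

lemma AE_add_ne_0: "AE \<zeta> in lborel. (a::complex) + \<zeta> \<noteq> 0"
  using AE_lborel_singleton[of "-a"] by eventually_elim (simp add: add_eq_0_iff)

text \<open>The two summands of the splitting have the same integral by translation invariance,
  hence the factor 2. The bound does not depend on the shift \<open>a\<close>; this is the source of
  boundedness on entire fibers.\<close>

lemma shifted_kernel_integrable:
  assumes "\<epsilon> > 0"
  shows "integrable lborel (\<lambda>\<zeta>::complex. 1 / norm \<zeta> * radial_weight \<epsilon> (norm (a + \<zeta>)))"
    "(LINT \<zeta>|lborel. 1 / norm \<zeta> * radial_weight \<epsilon> (norm (a + \<zeta>)))
      \<le> 2 * (LINT \<zeta>|lborel. 1 / norm (\<zeta>::complex) * radial_weight \<epsilon> (norm \<zeta>))"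
proof -
  let ?P = "\<lambda>\<zeta>::complex. 1 / norm \<zeta> * radial_weight \<epsilon> (norm \<zeta>)"
  have P: "integrable lborel ?P" by (rule integrable_radial_kernel[OF assms])
  have Pa: "integrable lborel (\<lambda>\<zeta>. ?P (a + \<zeta>))" by (rule lborel_integrable_translate[OF P])
  have ae: "AE \<zeta> in lborel. 1 / norm \<zeta> * radial_weight \<epsilon> (norm (a + \<zeta>)) \<le> ?P \<zeta> + ?P (a + \<zeta>)"
    using AE_add_ne_0[of a] by eventually_elim (rule cauchy_kernel_weight_split[OF assms])
  show int: "integrable lborel (\<lambda>\<zeta>::complex. 1 / norm \<zeta> * radial_weight \<epsilon> (norm (a + \<zeta>)))"
  proof (rule Bochner_Integration.integrable_bound)
    show "integrable lborel (\<lambda>\<zeta>. ?P \<zeta> + ?P (a + \<zeta>))" using P Pa by (rule Bochner_Integration.integrable_add)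
    show "AE \<zeta> in lborel. norm (1 / norm \<zeta> * radial_weight \<epsilon> (norm (a + \<zeta>))) \<le> norm (?P \<zeta> + ?P (a + \<zeta>))"
      using ae by eventually_elim (simp add: radial_weight_nonneg)
  qed measurable
  have "(LINT \<zeta>|lborel. 1 / norm \<zeta> * radial_weight \<epsilon> (norm (a + \<zeta>))) \<le> (LINT \<zeta>|lborel. ?P \<zeta> + ?P (a + \<zeta>))"
    using int P Pa ae by (intro integral_mono_AE Bochner_Integration.integrable_add) auto
  also have "\<dots> = 2 * (LINT \<zeta>|lborel. ?P \<zeta>)"
    using P Pa lborel_integral_translate[of ?P a] borel_measurable_integrable[OF P]
    by (subst Bochner_Integration.integral_add) auto
  finally show "(LINT \<zeta>|lborel. 1 / norm \<zeta> * radial_weight \<epsilon> (norm (a + \<zeta>)))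
      \<le> 2 * (LINT \<zeta>|lborel. 1 / norm (\<zeta>::complex) * radial_weight \<epsilon> (norm \<zeta>))" .
qed

text \<open>The plane is split according to which of \<open>\<zeta>\<close> and \<open>t + \<zeta>\<close> is smaller; after a translation
  of the second part, both parts are dominated by the integrable radial kernel.\<close>

lemma shifted_kernel_tendsto_0:
  assumes "\<epsilon> > 0"
  shows "((\<lambda>t. LINT \<zeta>|lborel. 1 / norm \<zeta> * radial_weight \<epsilon> (norm (complex_of_real t + \<zeta>))) \<longlongrightarrow> 0) at_top"
proof -
  let ?P = "\<lambda>\<zeta>::complex. 1 / norm \<zeta> * radial_weight \<epsilon> (norm \<zeta>)"
  let ?Q = "\<lambda>t (\<zeta>::complex). 1 / norm \<zeta> * radial_weight \<epsilon> (norm (complex_of_real t + \<zeta>))"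
  have P: "integrable lborel ?P" by (rule integrable_radial_kernel[OF assms])
  have inf: "filterlim (\<lambda>t. norm (complex_of_real t + \<zeta>)) at_top at_top" for \<zeta> :: complex
  proof (rule filterlim_at_top_mono)
    show "filterlim (\<lambda>t. t + - norm \<zeta>) at_top at_top"
      by (rule filterlim_tendsto_add_at_top[OF tendsto_const filterlim_ident, of "- norm \<zeta>", THEN filterlim_cong[THEN iffD1, rotated -1]]) auto
    show "\<forall>\<^sub>F t in at_top. t + - norm \<zeta> \<le> norm (complex_of_real t + \<zeta>)"
    proof (rule always_eventually, rule allI)
      fix t
      have "\<bar>t\<bar> - norm \<zeta> \<le> norm (complex_of_real t + \<zeta>)"
        using norm_diff_ineq[of "complex_of_real t" \<zeta>] by simp
      then show "t + - norm \<zeta> \<le> norm (complex_of_real t + \<zeta>)" by linarith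
    qed
  qed
  have w0: "((\<lambda>x. radial_weight \<epsilon> x) \<longlongrightarrow> 0) at_top"
    unfolding radial_weight_def using assms by real_asymp
  define A where "A t \<zeta> = (if norm \<zeta> \<le> norm (complex_of_real t + \<zeta>) then ?Q t \<zeta> else 0)" for t \<zeta>
  define B where "B t \<zeta> = (if norm (\<zeta> - of_real t) > norm \<zeta> then 1 / norm (\<zeta> - complex_of_real t) * radial_weight \<epsilon> (norm \<zeta>) else 0)" for t and \<zeta> :: complex
  have [measurable]: "A t \<in> borel_measurable borel" "B t \<in> borel_measurable borel" for t
    unfolding A_def[abs_def] B_def[abs_def] by measurable
  have Ab: "norm (A t \<zeta>) \<le> ?P \<zeta>" for t \<zeta>
  proof (cases "norm \<zeta> \<le> norm (complex_of_real t + \<zeta>)")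
    case True
    then have "?Q t \<zeta> \<le> ?P \<zeta>"
      using assms by (intro mult_left_mono radial_weight_antimono) auto
    then show ?thesis using True by (simp add: A_def radial_weight_nonneg)
  qed (simp add: A_def radial_weight_nonneg)
  have Bb: "AE \<zeta> in lborel. norm (B t \<zeta>) \<le> ?P \<zeta>" for t
    using AE_add_ne_0[of 0]
  proof eventually_elim
    case (elim \<zeta>)
    then show ?case
      by (auto simp: B_def radial_weight_nonneg intro!: divide_left_mono mult_right_mono mult_pos_pos)
  qed
  have Bi: "integrable lborel (B t)" for t
    by (rule Bochner_Integration.integrable_bound[OF P]) (use Bb[of t] in \<open>auto elim!: eventually_mono simp: radial_weight_nonneg\<close>)
  have Ai: "integrable lborel (A t)" for t
    by (rule Bochner_Integration.integrable_bound[OF P]) (use Ab[of t] in \<open>auto simp: radial_weight_nonneg\<close>)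
  have sum: "(LINT \<zeta>|lborel. ?Q t \<zeta>) = (LINT \<zeta>|lborel. A t \<zeta>) + (LINT \<zeta>|lborel. B t \<zeta>)" for t
  proof -
    have "?Q t = (\<lambda>\<zeta>. A t \<zeta> + B t (of_real t + \<zeta>))" by (auto simp: A_def B_def)
    then have "(LINT \<zeta>|lborel. ?Q t \<zeta>) = (LINT \<zeta>|lborel. A t \<zeta>) + (LINT \<zeta>|lborel. B t (of_real t + \<zeta>))"
      using Bochner_Integration.integral_add[OF Ai[of t] lborel_integrable_translate[OF Bi[of t], of "of_real t"]] by simp
    then show ?thesis by (simp add: lborel_integral_translate)
  qed
  \<comment> \<open>The two parts vanish for different reasons: in \<open>A\<close> the weight tends
    to 0 while the kernel stays fixed, in the translated part \<open>B\<close> the weight stays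
    fixed and the kernel tends to 0.\<close>
  have LA: "((\<lambda>t. LINT \<zeta>|lborel. A t \<zeta>) \<longlongrightarrow> (LINT \<zeta>::complex|lborel. 0)) at_top"
  proof (rule integral_dominated_convergence_at_top[where w="?P"])
    show "AE \<zeta> in lborel. ((\<lambda>t. A t \<zeta>) \<longlongrightarrow> 0) at_top"
    proof (rule AE_I2)
      fix \<zeta> :: complex
      have "((\<lambda>t. ?Q t \<zeta>) \<longlongrightarrow> 1 / norm \<zeta> * 0) at_top"
        by (intro tendsto_mult_left filterlim_compose[OF w0 inf])
      then have "((\<lambda>t. ?Q t \<zeta>) \<longlongrightarrow> 0) at_top" by simp
      then show "((\<lambda>t. A t \<zeta>) \<longlongrightarrow> 0) at_top"
        by (rule Lim_null_comparison[rotated]) (auto simp: A_def radial_weight_nonneg)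
    qed
    show "\<forall>\<^sub>F t in at_top. AE \<zeta> in lborel. norm (A t \<zeta>) \<le> ?P \<zeta>" using Ab by auto
  qed (use P in auto)
  have LB: "((\<lambda>t. LINT \<zeta>|lborel. B t \<zeta>) \<longlongrightarrow> (LINT \<zeta>::complex|lborel. 0)) at_top"
  proof (rule integral_dominated_convergence_at_top[where w="?P"])
    show "AE \<zeta> in lborel. ((\<lambda>t. B t \<zeta>) \<longlongrightarrow> 0) at_top"
    proof (rule AE_I2)
      fix \<zeta> :: complex
      have "filterlim (\<lambda>t. norm (\<zeta> - complex_of_real t)) at_top at_top"
        using inf[of "-\<zeta>"] by (simp add: norm_minus_commute)
      then have "((\<lambda>t. inverse (norm (\<zeta> - complex_of_real t))) \<longlongrightarrow> 0) at_top"
        using filterlim_compose tendsto_inverse_0_at_top by blast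
      then have "((\<lambda>t. inverse (norm (\<zeta> - complex_of_real t)) * radial_weight \<epsilon> (norm \<zeta>)) \<longlongrightarrow> 0) at_top"
        using tendsto_mult_left_zero by blast
      then show "((\<lambda>t. B t \<zeta>) \<longlongrightarrow> 0) at_top"
        by (rule Lim_null_comparison[rotated]) (auto simp: B_def radial_weight_nonneg divide_inverse)
    qed
    show "\<forall>\<^sub>F t in at_top. AE \<zeta> in lborel. norm (B t \<zeta>) \<le> ?P \<zeta>" using Bb by auto
  qed (use P in auto)
  show ?thesis unfolding sum using tendsto_add[OF LA LB] by simp
qed

text \<open>Substituting \<open>c * \<zeta>\<close> with \<open>c = a / norm a\<close> leaves
  \<open>1 / norm \<zeta>\<close> unchanged and turns the shift by \<open>a\<close> into the shift
  by its modulus. This is how the modulus of \<open>w\<^sub>\<delta>\<close> enters the kernel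
  bound.\<close>

lemma lborel_integral_rotate_shift:
  fixes F :: "real \<Rightarrow> real" and a :: complex
  assumes [measurable]: "F \<in> borel_measurable borel"
  shows "(LINT \<zeta>|lborel. 1 / norm \<zeta> * F (norm (a + \<zeta>)))
    = (LINT \<zeta>|lborel. 1 / norm \<zeta> * F (norm (complex_of_real (norm a) + \<zeta>)))"
proof (cases "a = 0")
  case False
  define c where "c = a / of_real (norm a)"
  have c: "norm c = 1" "a = c * of_real (norm a)" using False by (auto simp: c_def norm_divide)
  have "(LINT \<zeta>|lborel. 1 / norm \<zeta> * F (norm (a + \<zeta>)))
    = (LINT \<zeta>|distr lborel borel (\<lambda>\<zeta>. c * \<zeta>). 1 / norm \<zeta> * F (norm (a + \<zeta>)))"
    by (simp add: lborel_distr_isometry_complex[OF c(1)])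
  also have "\<dots> = (LINT \<zeta>|lborel. 1 / norm (c * \<zeta>) * F (norm (a + c * \<zeta>)))"
    by (rule integral_distr) auto
  also have "\<dots> = (LINT \<zeta>|lborel. 1 / norm \<zeta> * F (norm (complex_of_real (norm a) + \<zeta>)))"
  proof (intro Bochner_Integration.integral_cong refl)
    fix \<zeta>
    have "a + c * \<zeta> = c * (of_real (norm a) + \<zeta>)" using c(2) by (metis distrib_left)
    then show "1 / norm (c * \<zeta>) * F (norm (a + c * \<zeta>)) = 1 / norm \<zeta> * F (norm (complex_of_real (norm a) + \<zeta>))"
      using c(1) by (simp add: norm_mult)
  qed
  finally show ?thesis .
qed auto

section \<open>Differentiation under the integral sign\<close>

lemma continuous_on_lebesgue_integral:
  fixes g :: "'a::metric_space \<Rightarrow> 'c \<Rightarrow> 'b::{banach, second_countable_topology}"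
  assumes cont: "\<And>\<zeta>. \<zeta> \<in> space M \<Longrightarrow> continuous_on N (\<lambda>q. g q \<zeta>)"
    and meas: "\<And>q. q \<in> N \<Longrightarrow> g q \<in> borel_measurable M"
    and bound: "\<And>q \<zeta>. q \<in> N \<Longrightarrow> \<zeta> \<in> space M \<Longrightarrow> norm (g q \<zeta>) \<le> G \<zeta>"
    and G: "integrable M G"
  shows "continuous_on N (\<lambda>q. LINT \<zeta>|M. g q \<zeta>)"
  unfolding continuous_on_sequentially
proof (intro ballI allI impI, elim conjE)
  fix x a assume a: "a \<in> N" and x: "\<forall>n::nat. x n \<in> N" and lim: "x \<longlonglongrightarrow> a"
  have "(\<lambda>n. LINT \<zeta>|M. g (x n) \<zeta>) \<longlonglongrightarrow> (LINT \<zeta>|M. g a \<zeta>)"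
  proof (rule integral_dominated_convergence[OF _ _ G])
    show "AE \<zeta> in M. (\<lambda>n. g (x n) \<zeta>) \<longlonglongrightarrow> g a \<zeta>"
      using cont a x lim by (intro AE_I2) (auto simp: continuous_on_sequentially o_def)
  qed (use meas bound a x in auto)
  then show "((\<lambda>q. LINT \<zeta>|M. g q \<zeta>) \<circ> x) \<longlonglongrightarrow> (LINT \<zeta>|M. g a \<zeta>)" by (simp add: o_def)
qed

text \<open>Dominated convergence for the remainder divided by \<open>norm h\<close>. Its majorant
  is \<open>2 * G\<close>: one \<open>G\<close> from the mean value inequality on the convex set
  \<open>N\<close>, the other from the derivative at \<open>p\<close>.\<close>

lemma has_derivative_lebesgue_integral:
  fixes f :: "'a::real_normed_vector \<Rightarrow> 'c \<Rightarrow> 'b::{banach, second_countable_topology}"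
  assumes N: "open N" "convex N" "p \<in> N"
    and der: "\<And>q \<zeta>. q \<in> N \<Longrightarrow> \<zeta> \<in> space M \<Longrightarrow> ((\<lambda>q. f q \<zeta>) has_derivative f' q \<zeta>) (at q)"
    and int: "\<And>q. q \<in> N \<Longrightarrow> integrable M (f q)"
    and meas: "\<And>v. (\<lambda>\<zeta>. f' p \<zeta> v) \<in> borel_measurable M"
    and bound: "\<And>q \<zeta> v. q \<in> N \<Longrightarrow> \<zeta> \<in> space M \<Longrightarrow> norm (f' q \<zeta> v) \<le> G \<zeta> * norm v"
    and G: "integrable M G"
  shows "((\<lambda>q. LINT \<zeta>|M. f q \<zeta>) has_derivative (\<lambda>v. LINT \<zeta>|M. f' p \<zeta> v)) (at p)"
proof -
  have G0: "0 \<le> G \<zeta>" if "\<zeta> \<in> space M" "v \<noteq> (0::'a)" for \<zeta> v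
    using order_trans[OF norm_ge_zero bound[OF N(3) that(1), of v]] that(2) by (simp add: zero_le_mult_iff)
  have lin: "linear (f' p \<zeta>)" if "\<zeta> \<in> space M" for \<zeta>
    using has_derivative_linear[OF der[OF N(3) that]] .
  have int': "integrable M (\<lambda>\<zeta>. f' p \<zeta> v)" for v
    by (rule Bochner_Integration.integrable_bound[OF integrable_mult_left[OF G, of "norm v"] meas])
      (use bound[OF N(3)] in \<open>auto intro!: AE_I2 order_trans[OF _ abs_ge_self]\<close>)
  have bl: "bounded_linear (\<lambda>v. LINT \<zeta>|M. f' p \<zeta> v)"
  proof (rule bounded_linear_intro[where K="LINT \<zeta>|M. G \<zeta>"])
    fix x y r
    have "(LINT \<zeta>|M. f' p \<zeta> (x + y)) = (LINT \<zeta>|M. f' p \<zeta> x + f' p \<zeta> y)"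
      using lin by (intro Bochner_Integration.integral_cong) (auto simp: linear_add)
    then show "(LINT \<zeta>|M. f' p \<zeta> (x + y)) = (LINT \<zeta>|M. f' p \<zeta> x) + (LINT \<zeta>|M. f' p \<zeta> y)"
      using int' by simp
    have "(LINT \<zeta>|M. f' p \<zeta> (r *\<^sub>R x)) = (LINT \<zeta>|M. r *\<^sub>R f' p \<zeta> x)"
      using lin by (intro Bochner_Integration.integral_cong) (auto simp: linear_scale)
    then show "(LINT \<zeta>|M. f' p \<zeta> (r *\<^sub>R x)) = r *\<^sub>R (LINT \<zeta>|M. f' p \<zeta> x)" by simp
    have "norm (LINT \<zeta>|M. f' p \<zeta> x) \<le> (LINT \<zeta>|M. G \<zeta> * norm x)"
      by (rule order_trans[OF integral_norm_bound integral_mono])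
        (use int' G bound[OF N(3)] in auto)
    then show "norm (LINT \<zeta>|M. f' p \<zeta> x) \<le> norm x * (LINT \<zeta>|M. G \<zeta>)" by (simp add: mult.commute)
  qed
  let ?Q = "\<lambda>h \<zeta>. (f (p + h) \<zeta> - f p \<zeta> - f' p \<zeta> h) /\<^sub>R norm h"
  have Qb: "norm (?Q h \<zeta>) \<le> 2 * G \<zeta>" if "p + h \<in> N" "h \<noteq> 0" "\<zeta> \<in> space M" for h \<zeta>
  proof -
    have "norm (f (p + h) \<zeta> - f p \<zeta>) \<le> G \<zeta> * norm (p + h - p)"
    proof (rule differentiable_bound[OF N(2)])
      fix q assume q: "q \<in> N"
      show "((\<lambda>q. f q \<zeta>) has_derivative f' q \<zeta>) (at q within N)"
        using der[OF q that(3)] has_derivative_at_withinI by blast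
      show "onorm (f' q \<zeta>) \<le> G \<zeta>"
        using bound[OF q that(3)] G0[OF that(3,2)] by (intro onorm_bound) auto
    qed (use that N in auto)
    then have "norm (f (p + h) \<zeta> - f p \<zeta> - f' p \<zeta> h) \<le> 2 * G \<zeta> * norm h"
      using bound[OF N(3) that(3), of h] norm_triangle_ineq4[of "f (p + h) \<zeta> - f p \<zeta>" "f' p \<zeta> h"] by simp
    then show ?thesis using that(2) by (simp add: pos_divide_le_eq flip: divide_inverse_commute)
  qed
  show ?thesis unfolding has_derivative_at
  proof (intro conjI bl)
    show "((\<lambda>h. norm ((LINT \<zeta>|M. f (p + h) \<zeta>) - (LINT \<zeta>|M. f p \<zeta>) - (LINT \<zeta>|M. f' p \<zeta> h)) / norm h) \<longlongrightarrow> 0) (at 0)"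
      unfolding tendsto_at_iff_sequentially
    proof (intro allI impI)
      fix X :: "nat \<Rightarrow> 'a" assume X: "\<forall>i. X i \<in> UNIV - {0}" "X \<longlonglongrightarrow> 0"
      have "(\<lambda>i. p + X i) \<longlonglongrightarrow> p + 0" using X(2) by (intro tendsto_intros)
      then have ev: "\<forall>\<^sub>F i in sequentially. p + X i \<in> N"
        using topological_tendstoD N by fastforce
      \<comment> \<open>Set to 0 for the indices at which \<open>p + X i\<close> has not yet entered
        \<open>N\<close>, so that the majorant holds for every index.\<close>
      define s where "s i = (if p + X i \<in> N then ?Q (X i) else (\<lambda>_. 0))" for i
      have smeas: "s i \<in> borel_measurable M" for i
        using borel_measurable_integrable[OF int] meas N(3) unfolding s_def by simp
      have "(\<lambda>i. LINT \<zeta>|M. s i \<zeta>) \<longlonglongrightarrow> (LINT \<zeta>|M. 0)"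
      proof (rule integral_dominated_convergence)
        show "integrable M (\<lambda>\<zeta>. 2 * \<bar>G \<zeta>\<bar>)" using G by simp
        show "AE \<zeta> in M. (\<lambda>i. s i \<zeta>) \<longlonglongrightarrow> 0"
        proof (rule AE_I2)
          fix \<zeta> assume \<zeta>: "\<zeta> \<in> space M"
          have "((\<lambda>h. norm (f (p + h) \<zeta> - f p \<zeta> - f' p \<zeta> h) / norm h) \<longlongrightarrow> 0) (at 0)"
            using der[OF N(3) \<zeta>] by (simp add: has_derivative_at)
          then have "(\<lambda>i. norm (?Q (X i) \<zeta>)) \<longlonglongrightarrow> 0"
            unfolding tendsto_at_iff_sequentially using X by (force simp: o_def divide_inverse mult.commute)
          then have "(\<lambda>i. ?Q (X i) \<zeta>) \<longlonglongrightarrow> 0" by (rule tendsto_norm_zero_cancel)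
          then show "(\<lambda>i. s i \<zeta>) \<longlonglongrightarrow> 0"
            by (rule Lim_transform_eventually) (use ev in \<open>auto elim!: eventually_mono simp: s_def\<close>)
        qed
        show "AE \<zeta> in M. norm (s i \<zeta>) \<le> 2 * \<bar>G \<zeta>\<bar>" for i
          using Qb[of "X i"] X(1) by (intro AE_I2) (fastforce simp: s_def)
      qed (use smeas in auto)
      then have "(\<lambda>i. norm (LINT \<zeta>|M. s i \<zeta>)) \<longlonglongrightarrow> 0" by (simp add: tendsto_norm_zero)
      then show "((\<lambda>h. norm ((LINT \<zeta>|M. f (p + h) \<zeta>) - (LINT \<zeta>|M. f p \<zeta>) - (LINT \<zeta>|M. f' p \<zeta> h)) / norm h) \<circ> X) \<longlonglongrightarrow> 0"
      proof (rule Lim_transform_eventually)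
        show "\<forall>\<^sub>F i in sequentially. norm (LINT \<zeta>|M. s i \<zeta>) =
          ((\<lambda>h. norm ((LINT \<zeta>|M. f (p + h) \<zeta>) - (LINT \<zeta>|M. f p \<zeta>) - (LINT \<zeta>|M. f' p \<zeta> h)) / norm h) \<circ> X) i"
          using ev
        proof eventually_elim
          case (elim i)
          then have "(LINT \<zeta>|M. s i \<zeta>) = ((LINT \<zeta>|M. f (p + X i) \<zeta>) - (LINT \<zeta>|M. f p \<zeta>) - (LINT \<zeta>|M. f' p \<zeta> (X i))) /\<^sub>R norm (X i)"
            using int[OF elim] int[OF N(3)] int' by (simp add: s_def)
          then show ?case by (simp add: divide_inverse mult.commute)
        qed
      qed
    qed
  qed
qed

section \<open>Solutions in a chart\<close>

lemma coord_vec_eq_scaleR: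
  "coord_vec i c = Re c *\<^sub>R coord_vec i 1 + Im c *\<^sub>R coord_vec i \<i>"
  by (cases i) (auto simp: vec_eq_iff axis_def complex_eq_iff)

lemma model_eq_sum_coord_vec: "v = (\<Sum>i\<in>UNIV. coord_vec i (coord i v))"
proof -
  have "(\<Sum>i\<in>UNIV. coord_vec i (coord i v)) = (\<Sum>\<alpha>\<in>UNIV. (axis \<alpha> (fst v $ \<alpha>), 0)) + (\<Sum>\<gamma>\<in>UNIV. (0, axis \<gamma> (snd v $ \<gamma>)))"
    unfolding UNIV_Plus_UNIV[symmetric] by (subst sum.Plus) auto
  also have "\<dots> = v"
    by (auto simp: prod_eq_iff fst_sum snd_sum vec_eq_iff axis_def)
  finally show ?thesis by simp
qed

lemma linear_model_expand:
  assumes "linear L"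
  shows "L v = (\<Sum>i\<in>UNIV. Re (coord i v) *\<^sub>R L (coord_vec i 1) + Im (coord i v) *\<^sub>R L (coord_vec i \<i>))"
proof -
  have "L v = (\<Sum>i\<in>UNIV. L (coord_vec i (coord i v)))"
    by (subst model_eq_sum_coord_vec) (simp add: linear_sum[OF assms])
  also have "\<dots> = (\<Sum>i\<in>UNIV. Re (coord i v) *\<^sub>R L (coord_vec i 1) + Im (coord i v) *\<^sub>R L (coord_vec i \<i>))"
    by (subst coord_vec_eq_scaleR) (simp add: linear_add[OF assms] linear_scale[OF assms])
  finally show ?thesis .
qed

lemma norm_coord_le: "norm (coord i v) \<le> norm v"
proof (cases i)
  case (Inl \<alpha>)
  then show ?thesis using order_trans[OF Finite_Cartesian_Product.norm_nth_le norm_fst_le[of "fst v" "snd v"]] by simp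
next
  case (Inr \<gamma>)
  then show ?thesis using order_trans[OF Finite_Cartesian_Product.norm_nth_le norm_snd_le[of "snd v" "fst v"]] by simp
qed

lemma bounded_linear_coord_vec: "bounded_linear (coord_vec i)"
  unfolding linear_conv_bounded_linear[symmetric]
  by (cases i; rule linearI) (auto simp: vec_eq_iff axis_def)

lemma dir_deriv_eq: "(f has_derivative f') (at p) \<Longrightarrow> dir_deriv v f p = f' v"
  by (simp add: dir_deriv_def frechet_derivative_at[symmetric])

lemma C1_on_has_derivative:
  assumes "C1_on A f" "p \<in> A"
  shows "(f has_derivative (\<lambda>v. dir_deriv v f p)) (at p)"
  using assms frechet_derivative_works unfolding dir_deriv_def C1_on_def by blast

lemma C1_on_continuous: "C1_on A f \<Longrightarrow> continuous_on A f"
  unfolding C1_on_def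
  by (meson differentiable_imp_continuous_within continuous_at_imp_continuous_on)

lemma C1_on_continuous_dir_deriv: "C1_on A f \<Longrightarrow> continuous_on A (dir_deriv v f)"
  unfolding C1_on_def by blast

lemma integrable_dominated:
  fixes f :: "'a \<Rightarrow> 'b::{banach, second_countable_topology}"
  assumes "integrable M G" "f \<in> borel_measurable M" "\<And>x. norm (f x) \<le> G x"
  shows "integrable M f"
  by (rule Bochner_Integration.integrable_bound[OF assms(1,2)])
    (auto intro!: AE_I2 order_trans[OF assms(3)])

section \<open>Fiber weights along a coordinate line and the kernel integral\<close>

lemma fiber_weight_ge_1: "1 \<le> fiber_weight \<epsilon> w"
  by (simp add: fiber_weight_def sum_nonneg)

lemma fiber_weight_axis:
  "fiber_weight \<epsilon> (w + axis \<delta> \<zeta>)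
    = 1 + (\<Sum>j\<in>UNIV - {\<delta>}. norm (w $ j) powr (1 + \<epsilon>)) + norm (w $ \<delta> + \<zeta>) powr (1 + \<epsilon>)"
proof -
  have "(\<Sum>j\<in>UNIV. norm ((w + axis \<delta> \<zeta>) $ j) powr (1 + \<epsilon>))
    = norm ((w + axis \<delta> \<zeta>) $ \<delta>) powr (1 + \<epsilon>) + (\<Sum>j\<in>UNIV - {\<delta>}. norm ((w + axis \<delta> \<zeta>) $ j) powr (1 + \<epsilon>))"
    by (rule sum.remove) auto
  also have "(\<Sum>j\<in>UNIV - {\<delta>}. norm ((w + axis \<delta> \<zeta>) $ j) powr (1 + \<epsilon>)) = (\<Sum>j\<in>UNIV - {\<delta>}. norm (w $ j) powr (1 + \<epsilon>))"
    by (rule sum.cong) (auto simp: axis_def)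
  finally show ?thesis by (simp add: fiber_weight_def axis_def)
qed

lemma inverse_fiber_weight_le:
  "1 / fiber_weight \<epsilon> (w + axis \<delta> \<zeta>) \<le> radial_weight \<epsilon> (norm (w $ \<delta> + \<zeta>))"
  unfolding radial_weight_def fiber_weight_axis
  by (intro divide_left_mono mult_pos_pos add_pos_nonneg) (auto simp: sum_nonneg add_nonneg_nonneg)

text \<open>Shifts by a bounded amount change the weight by a bounded factor: with
  \<open>y = norm (a + \<zeta>)\<close>,
  \<open>norm \<zeta> \<le> A + y \<le> (1 + A) * max 1 y\<close>, and the 2 absorbs the summand 1
  of the denominator. It serves to give one majorant for all points near a given one.\<close>

lemma radial_weight_shift_le:
  fixes a \<zeta> :: complex
  assumes "\<epsilon> > 0" "norm a \<le> A"
  shows "radial_weight \<epsilon> (norm (a + \<zeta>)) \<le> 2 * (1 + A) powr (1 + \<epsilon>) * radial_weight \<epsilon> (norm \<zeta>)"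
proof -
  define q where "q = 1 + \<epsilon>"
  define y where "y = norm (a + \<zeta>)"
  have A: "A \<ge> 0" using assms norm_ge_zero order_trans by blast
  have "norm \<zeta> \<le> A + y" using norm_triangle_ineq4[of "a + \<zeta>" a] assms by (simp add: y_def)
  also have "A + y \<le> (1 + A) * max 1 y"
  proof -
    have "A * 1 \<le> A * max 1 y" using A by (intro mult_left_mono) auto
    then show ?thesis by (simp add: algebra_simps)
  qed
  finally have "norm \<zeta> powr q \<le> ((1 + A) * max 1 y) powr q" using assms by (intro powr_mono2) (auto simp: q_def)
  also have "\<dots> = (1 + A) powr q * max 1 y powr q" using A by (simp add: powr_mult)
  also have "max 1 y powr q \<le> 1 + y powr q" by (auto simp: max_def)
  finally have z: "norm \<zeta> powr q \<le> (1 + A) powr q * (1 + y powr q)" by (simp add: mult_left_mono)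
  have "1 \<le> (1 + A) powr q" using A assms by (intro ge_one_powr_ge_zero) (auto simp: q_def)
  then have "1 * 1 \<le> (1 + A) powr q * (1 + y powr q)" by (intro mult_mono) auto
  with z have *: "1 + norm \<zeta> powr q \<le> 2 * (1 + A) powr q * (1 + y powr q)" by linarith
  have pos: "1 + norm \<zeta> powr q > 0" "1 + y powr q > 0" by (auto simp: add_pos_nonneg)
  have "1 / (1 + y powr q) \<le> 2 * (1 + A) powr q * (1 / (1 + norm \<zeta> powr q))"
    using * pos by (simp add: divide_simps mult_ac)
  then show ?thesis by (simp add: radial_weight_def q_def y_def)
qed

text \<open>The sum over the coordinates other than \<delta> is constant in \<zeta>, so a rotation
  replaces the modulus of \<open>w $ \<delta>\<close> by \<open>w $ \<delta>\<close> itself. The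
  kernel bound thereby becomes an integral over the complex line that \<open>fiber_cauchy\<close>
  uses.\<close>

lemma kernel_bound_eq:
  "kernel_bound \<epsilon> \<delta> w = 2 * (LINT \<zeta>|lborel. 1 / norm \<zeta> * (1 / fiber_weight \<epsilon> (w + axis \<delta> \<zeta>)))"
proof -
  define F where "F x = 1 / (1 + (\<Sum>j\<in>UNIV - {\<delta>}. norm (w $ j) powr (1 + \<epsilon>)) + x powr (1 + \<epsilon>))" for x :: real
  have [measurable]: "F \<in> borel_measurable borel" unfolding F_def by measurable
  show ?thesis
    unfolding kernel_bound_def fiber_weight_axis
    using lborel_integral_rotate_shift[of F "w $ \<delta>"] by (simp add: F_def)
qed

lemma fiber_kernel_measurable [measurable]:
  "(\<lambda>\<zeta>. 1 / norm \<zeta> * (1 / fiber_weight \<epsilon> (w + axis \<delta> \<zeta>))) \<in> borel_measurable borel"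
  unfolding fiber_weight_axis by measurable

lemma fiber_kernel_integrable:
  assumes "\<epsilon> > 0"
  shows "integrable lborel (\<lambda>\<zeta>. 1 / norm \<zeta> * (1 / fiber_weight \<epsilon> (w + axis \<delta> \<zeta>)))"
proof (rule Bochner_Integration.integrable_bound[OF shifted_kernel_integrable(1)[OF assms, of "w $ \<delta>"]])
  show "AE \<zeta> in lborel. norm (1 / norm \<zeta> * (1 / fiber_weight \<epsilon> (w + axis \<delta> \<zeta>)))
      \<le> norm (1 / norm \<zeta> * radial_weight \<epsilon> (norm (w $ \<delta> + \<zeta>)))"
  proof (rule AE_I2)
    fix \<zeta>
    show "norm (1 / norm \<zeta> * (1 / fiber_weight \<epsilon> (w + axis \<delta> \<zeta>))) \<le> norm (1 / norm \<zeta> * radial_weight \<epsilon> (norm (w $ \<delta> + \<zeta>)))"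
      using inverse_fiber_weight_le[of \<epsilon> w \<delta> \<zeta>] fiber_weight_ge_1[of \<epsilon> "w + axis \<delta> \<zeta>"]
      unfolding norm_mult by (intro mult_left_mono) (auto simp: radial_weight_nonneg)
  qed
qed measurable

text \<open>Dropping the other fiber coordinates leaves a bound in
  \<open>norm (w $ \<delta>)\<close> alone; decay in this coordinate is therefore uniform in
  \<open>w'\<close>.\<close>

lemma kernel_bound_le:
  assumes "\<epsilon> > 0"
  shows "kernel_bound \<epsilon> \<delta> w
    \<le> 2 * (LINT \<zeta>|lborel. 1 / norm \<zeta> * radial_weight \<epsilon> (norm (complex_of_real (norm (w $ \<delta>)) + \<zeta>)))"
proof -
  have "(LINT \<zeta>|lborel. 1 / norm \<zeta> * (1 / fiber_weight \<epsilon> (w + axis \<delta> \<zeta>)))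
    \<le> (LINT \<zeta>|lborel. 1 / norm \<zeta> * radial_weight \<epsilon> (norm (w $ \<delta> + \<zeta>)))"
    by (intro integral_mono fiber_kernel_integrable shifted_kernel_integrable assms mult_left_mono inverse_fiber_weight_le) auto
  then show ?thesis unfolding kernel_bound_eq using lborel_integral_rotate_shift[of "radial_weight \<epsilon>" "w $ \<delta>"] by simp
qed

lemma kernel_bound_bounded:
  assumes "\<epsilon> > 0" obtains M where "\<And>\<delta> w. kernel_bound \<epsilon> \<delta> w \<le> M"
  using order_trans[OF kernel_bound_le[OF assms] mult_left_mono[OF shifted_kernel_integrable(2)[OF assms]]] by fastforce

lemma kernel_bound_decay:
  assumes "\<epsilon> > 0" "e > 0"
  obtains R where "\<And>\<delta> w. norm ((w :: complex^'k::finite) $ \<delta>) > R \<Longrightarrow> kernel_bound \<epsilon> \<delta> w < e"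
proof -
  have "\<forall>\<^sub>F t in at_top. (LINT \<zeta>|lborel. 1 / norm \<zeta> * radial_weight \<epsilon> (norm (complex_of_real t + \<zeta>))) < e / 2"
    using shifted_kernel_tendsto_0[OF assms(1)] assms(2) by (intro order_tendstoD) auto
  then obtain R where R: "\<And>t. t \<ge> R \<Longrightarrow> (LINT \<zeta>|lborel. 1 / norm \<zeta> * radial_weight \<epsilon> (norm (complex_of_real t + \<zeta>))) < e / 2"
    unfolding eventually_at_top_linorder by blast
  then have "kernel_bound \<epsilon> \<delta> w < e" if "norm (w $ \<delta>) > R" for \<delta> and w :: "complex^'k"
  proof -
    have "(LINT \<zeta>|lborel. 1 / norm \<zeta> * radial_weight \<epsilon> (norm (complex_of_real (norm (w $ \<delta>)) + \<zeta>))) < e / 2"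
      using R that by simp
    then show ?thesis using kernel_bound_le[OF assms(1), of \<delta> w] by linarith
  qed
  then show thesis using that by blast
qed

text \<open>The integration variable is the displacement from \<open>p\<close>, so the singular
  factor \<open>1 / \<zeta>\<close> does not involve \<open>p\<close> and all derivatives fall on
  the coefficient. The factor \<open>- 1 / pi\<close> inverts the constant of
  \<open>Cauchy_Pompeiu_plane\<close>.\<close>

definition fiber_cauchy :: "('n::finite, 'k::finite) form01 \<Rightarrow> 'k \<Rightarrow> ('n, 'k) model \<Rightarrow> complex" where
  "fiber_cauchy \<eta> \<delta> p = - (LINT \<zeta>|lborel. \<eta> (Inr \<delta>) (p + coord_vec (Inr \<delta>) \<zeta>) / \<zeta>) / pi"

lemma decreasing_exponent_bounds:
  assumes "decreasing_exponent \<eta> K \<epsilon>"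
  obtains C where "C > 0"
    "\<And>p \<gamma>. fst p \<in> K \<Longrightarrow> norm (\<eta> (Inr \<gamma>) p) \<le> C / fiber_weight \<epsilon> (snd p)"
    "\<And>p \<gamma> v. fst p \<in> K \<Longrightarrow> \<eta> (Inr \<gamma>) differentiable (at p) \<Longrightarrow>
       norm (dir_deriv v (\<eta> (Inr \<gamma>)) p) \<le> C * norm v / fiber_weight \<epsilon> (snd p)"
proof -
  obtain C where C: "\<And>z w \<gamma>. z \<in> K \<Longrightarrow> norm (\<eta> (Inr \<gamma>) (z, w)) \<le> C / fiber_weight \<epsilon> w"
    "\<And>z w \<gamma> i. z \<in> K \<Longrightarrow> norm (partial_re i (\<eta> (Inr \<gamma>)) (z, w)) \<le> C / fiber_weight \<epsilon> w"
    "\<And>z w \<gamma> i. z \<in> K \<Longrightarrow> norm (partial_im i (\<eta> (Inr \<gamma>)) (z, w)) \<le> C / fiber_weight \<epsilon> w"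
    using assms unfolding decreasing_exponent_def by blast
  define m where "m = real (CARD('a + 'b))"
  have "m \<ge> 1" unfolding m_def using zero_less_card_finite[where 'a="'a + 'b"] by linarith
  \<comment> \<open>An arbitrary direction expands into \<open>m\<close> complex coordinates with
    two real directions each, which gives \<open>2 * m\<close>; the added 1 makes the constant
    positive.\<close>
  define C' where "C' = (2 * m) * (\<bar>C\<bar> + 1)"
  have CC': "C \<le> C'"
  proof -
    have "C \<le> 1 * (\<bar>C\<bar> + 1)" by simp
    also have "\<dots> \<le> 2 * m * (\<bar>C\<bar> + 1)" using \<open>m \<ge> 1\<close> by (intro mult_right_mono) auto
    finally show ?thesis unfolding C'_def .
  qed
  have fw: "fiber_weight \<epsilon> w > 0" for w :: "complex^'b" using fiber_weight_ge_1[of \<epsilon> w] by linarith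
  show thesis
  proof (rule that[of C'])
    show "C' > 0" using \<open>m \<ge> 1\<close> by (simp add: C'_def)
    show "norm (\<eta> (Inr \<gamma>) p) \<le> C' / fiber_weight \<epsilon> (snd p)" if "fst p \<in> K" for p \<gamma>
      using order_trans[OF C(1)[OF that, of \<gamma> "snd p"] divide_right_mono[OF CC']] fw[of "snd p"] by simp
    show "norm (dir_deriv v (\<eta> (Inr \<gamma>)) p) \<le> C' * norm v / fiber_weight \<epsilon> (snd p)"
      if p: "fst p \<in> K" "\<eta> (Inr \<gamma>) differentiable (at p)" for p \<gamma> v
    proof -
      let ?w = "fiber_weight \<epsilon> (snd p)"
      have pb: "norm (partial_re i (\<eta> (Inr \<gamma>)) p) \<le> \<bar>C\<bar> / ?w" "norm (partial_im i (\<eta> (Inr \<gamma>)) p) \<le> \<bar>C\<bar> / ?w" for i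
      proof -
        have "C / ?w \<le> \<bar>C\<bar> / ?w" using fw[of "snd p"] by (intro divide_right_mono) auto
        then show "norm (partial_re i (\<eta> (Inr \<gamma>)) p) \<le> \<bar>C\<bar> / ?w" "norm (partial_im i (\<eta> (Inr \<gamma>)) p) \<le> \<bar>C\<bar> / ?w"
          using C(2)[OF p(1), of i \<gamma> "snd p"] C(3)[OF p(1), of i \<gamma> "snd p"] by auto
      qed
      have "dir_deriv v (\<eta> (Inr \<gamma>)) p = (\<Sum>i\<in>UNIV. Re (coord i v) *\<^sub>R partial_re i (\<eta> (Inr \<gamma>)) p + Im (coord i v) *\<^sub>R partial_im i (\<eta> (Inr \<gamma>)) p)"
        unfolding dir_deriv_def by (rule linear_model_expand[OF linear_frechet_derivative[OF p(2)]])
      also have "norm \<dots> \<le> (\<Sum>i\<in>(UNIV::('a+'b) set). norm v * (\<bar>C\<bar> / ?w) + norm v * (\<bar>C\<bar> / ?w))"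
      proof (rule order_trans[OF norm_sum sum_mono])
        fix i
        have "norm (Re (coord i v) *\<^sub>R partial_re i (\<eta> (Inr \<gamma>)) p + Im (coord i v) *\<^sub>R partial_im i (\<eta> (Inr \<gamma>)) p)
          \<le> \<bar>Re (coord i v)\<bar> * norm (partial_re i (\<eta> (Inr \<gamma>)) p) + \<bar>Im (coord i v)\<bar> * norm (partial_im i (\<eta> (Inr \<gamma>)) p)"
          by (rule order_trans[OF norm_triangle_ineq]) simp
        also have "\<dots> \<le> norm v * (\<bar>C\<bar> / ?w) + norm v * (\<bar>C\<bar> / ?w)"
          using abs_Re_le_cmod[of "coord i v"] abs_Im_le_cmod[of "coord i v"] norm_coord_le[of i v]
          by (intro add_mono mult_mono pb) auto
        finally show "norm (Re (coord i v) *\<^sub>R partial_re i (\<eta> (Inr \<gamma>)) p + Im (coord i v) *\<^sub>R partial_im i (\<eta> (Inr \<gamma>)) p)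
          \<le> norm v * (\<bar>C\<bar> / ?w) + norm v * (\<bar>C\<bar> / ?w)" .
      qed
      also have "\<dots> = (2 * m * \<bar>C\<bar>) * norm v / ?w" by (simp add: m_def)
      also have "\<dots> \<le> C' * norm v / ?w"
        using fw[of "snd p"] \<open>m \<ge> 1\<close> by (intro divide_right_mono mult_right_mono) (auto simp: C'_def algebra_simps)
      finally show ?thesis .
    qed
  qed
qed

section \<open>Cauchy transforms of a closed decreasing form over one chart\<close>

locale decreasing_form =
  fixes \<eta> :: "('n::finite, 'k::finite) form01" and U :: "(complex^'n) set"
  assumes open_base: "open U"
    and C1: "C1_on (U \<times> UNIV) (\<eta> i)"
    and closed: "p \<in> U \<times> UNIV \<Longrightarrow> dbar_coeff \<eta> i j p = 0"
    and decreasing: "compact K \<Longrightarrow> K \<subseteq> U \<Longrightarrow> \<exists>\<epsilon>. decreasing_exponent \<eta> K \<epsilon>"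
begin

lemma shift_mem: "fst p \<in> U \<Longrightarrow> p + coord_vec (Inr \<delta>) \<zeta> \<in> U \<times> UNIV"
  by (auto simp: mem_Times_iff)

lemma continuous_shift:
  assumes "fst p \<in> U"
  shows "continuous_on UNIV (\<lambda>\<zeta>. \<eta> i (p + coord_vec (Inr \<delta>) \<zeta>))"
    "continuous_on UNIV (\<lambda>\<zeta>. dir_deriv v (\<eta> i) (p + coord_vec (Inr \<delta>) \<zeta>))"
proof -
  have s: "continuous_on UNIV (\<lambda>\<zeta>. p + coord_vec (Inr \<delta>) \<zeta>)"
    by (intro continuous_intros linear_continuous_on bounded_linear_coord_vec)
  have i: "(\<lambda>\<zeta>. p + coord_vec (Inr \<delta>) \<zeta>) ` UNIV \<subseteq> U \<times> UNIV" using shift_mem[OF assms] by blast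
  show "continuous_on UNIV (\<lambda>\<zeta>. \<eta> i (p + coord_vec (Inr \<delta>) \<zeta>))"
    by (rule continuous_on_compose2[OF C1_on_continuous[OF C1] s i])
  show "continuous_on UNIV (\<lambda>\<zeta>. dir_deriv v (\<eta> i) (p + coord_vec (Inr \<delta>) \<zeta>))"
    by (rule continuous_on_compose2[OF C1_on_continuous_dir_deriv[OF C1] s i])
qed

lemma shift_measurable:
  assumes "fst p \<in> U"
  shows "(\<lambda>\<zeta>. \<eta> i (p + coord_vec (Inr \<delta>) \<zeta>) / \<zeta>) \<in> borel_measurable lborel"
    "(\<lambda>\<zeta>. dir_deriv v (\<eta> i) (p + coord_vec (Inr \<delta>) \<zeta>) / \<zeta>) \<in> borel_measurable lborel"
  unfolding measurable_lborel2
  by (intro borel_measurable_divide borel_measurable_continuous_onI continuous_shift assms; simp)+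

text \<open>A closed ball around the base point is compact, hence has a single exponent and
  constant. For \<open>q\<close> near \<open>p\<close> the coordinate
  \<open>snd q $ \<delta>\<close> is bounded by \<open>A\<close>, so
  \<open>radial_weight_shift_le\<close> moves the weight to \<zeta> and frees it from
  \<open>q\<close>.\<close>

lemma local_majorant:
  assumes p: "fst p \<in> U"
  obtains r G where "r > 0" "integrable lborel G" "ball p r \<subseteq> U \<times> UNIV"
    "\<And>q \<zeta>. q \<in> ball p r \<Longrightarrow> norm (\<eta> (Inr \<delta>) (q + coord_vec (Inr \<delta>) \<zeta>) / \<zeta>) \<le> G \<zeta>"
    "\<And>q \<zeta> v. q \<in> ball p r \<Longrightarrow> norm (dir_deriv v (\<eta> (Inr \<delta>)) (q + coord_vec (Inr \<delta>) \<zeta>) / \<zeta>) \<le> G \<zeta> * norm v"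
proof -
  obtain r where r: "r > 0" "cball (fst p) r \<subseteq> U" using open_base p open_contains_cball by blast
  obtain \<epsilon> where eps: "decreasing_exponent \<eta> (cball (fst p) r) \<epsilon>" using decreasing[OF compact_cball r(2)] by blast
  then have "\<epsilon> > 0" by (simp add: decreasing_exponent_def)
  obtain C where C: "C > 0"
    "\<And>q \<gamma>. fst q \<in> cball (fst p) r \<Longrightarrow> norm (\<eta> (Inr \<gamma>) q) \<le> C / fiber_weight \<epsilon> (snd q)"
    "\<And>q \<gamma> v. fst q \<in> cball (fst p) r \<Longrightarrow> \<eta> (Inr \<gamma>) differentiable (at q) \<Longrightarrow>
       norm (dir_deriv v (\<eta> (Inr \<gamma>)) q) \<le> C * norm v / fiber_weight \<epsilon> (snd q)"
    using decreasing_exponent_bounds[OF eps] by metis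
  define A where "A = norm (snd p) + r"
  define c where "c = 2 * (1 + A) powr (1 + \<epsilon>)"
  define G where "G \<zeta> = C * c * (1 / norm \<zeta> * radial_weight \<epsilon> (norm \<zeta>))" for \<zeta> :: complex
  have q: "fst q \<in> cball (fst p) r" "norm (snd q $ \<delta>) \<le> A" if "q \<in> ball p r" for q
  proof -
    have "dist (fst p) (fst q) \<le> dist p q" "dist (snd p) (snd q) \<le> dist p q" by (auto simp: dist_fst_le dist_snd_le)
    then have *: "dist (fst p) (fst q) < r" "dist (snd p) (snd q) < r" using that by auto
    then show "fst q \<in> cball (fst p) r" by simp
    have "norm (snd q $ \<delta>) \<le> norm (snd q)" by (rule Finite_Cartesian_Product.norm_nth_le)
    also have "\<dots> \<le> norm (snd p) + dist (snd p) (snd q)" by (metis dist_norm norm_minus_commute norm_triangle_sub)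
    finally show "norm (snd q $ \<delta>) \<le> A" using * by (simp add: A_def)
  qed
  have wt: "1 / fiber_weight \<epsilon> (snd (q + coord_vec (Inr \<delta>) \<zeta>)) \<le> c * radial_weight \<epsilon> (norm \<zeta>)" if "q \<in> ball p r" for q \<zeta>
    using order_trans[OF inverse_fiber_weight_le[of \<epsilon> "snd q" \<delta> \<zeta>] radial_weight_shift_le[OF \<open>\<epsilon> > 0\<close> q(2)[OF that]]]
    by (simp add: c_def)
  have bd: "norm (x / \<zeta>) \<le> G \<zeta> * m" if x: "norm x \<le> C * m / fiber_weight \<epsilon> (snd (q + coord_vec (Inr \<delta>) \<zeta>))" and "q \<in> ball p r" "m \<ge> 0" for x q \<zeta> m
  proof -
    have "norm x \<le> (C * m) * (1 / fiber_weight \<epsilon> (snd (q + coord_vec (Inr \<delta>) \<zeta>)))" using x by simp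
    also have "\<dots> \<le> (C * m) * (c * radial_weight \<epsilon> (norm \<zeta>))"
      using that C(1) by (intro mult_left_mono wt) auto
    finally have "norm x / norm \<zeta> \<le> ((C * m) * (c * radial_weight \<epsilon> (norm \<zeta>))) / norm \<zeta>" by (rule divide_right_mono) auto
    then show ?thesis by (simp add: G_def norm_divide mult_ac)
  qed
  show thesis
  proof (rule that[of r G])
    show "r > 0" by (rule r)
    show "integrable lborel G" unfolding G_def by (intro integrable_mult_right integrable_radial_kernel \<open>\<epsilon> > 0\<close>)
    show "ball p r \<subseteq> U \<times> UNIV" using q(1) r(2) by (auto simp: mem_Times_iff subset_iff)
    show "norm (\<eta> (Inr \<delta>) (s + coord_vec (Inr \<delta>) \<zeta>) / \<zeta>) \<le> G \<zeta>" if s: "s \<in> ball p r" for s \<zeta>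
      using bd[of _ 1 s \<zeta>] C(2)[of "s + coord_vec (Inr \<delta>) \<zeta>" \<delta>] q(1)[OF s] s by simp
    show "norm (dir_deriv v (\<eta> (Inr \<delta>)) (s + coord_vec (Inr \<delta>) \<zeta>) / \<zeta>) \<le> G \<zeta> * norm v" if s: "s \<in> ball p r" for s \<zeta> v
    proof (rule bd[OF _ s norm_ge_zero])
      have "fst s \<in> U" using q(1)[OF s] r(2) by blast
      then have "\<eta> (Inr \<delta>) differentiable (at (s + coord_vec (Inr \<delta>) \<zeta>))"
        using C1_on_has_derivative[OF C1 shift_mem] unfolding differentiable_def by blast
      then show "norm (dir_deriv v (\<eta> (Inr \<delta>)) (s + coord_vec (Inr \<delta>) \<zeta>)) \<le> C * norm v / fiber_weight \<epsilon> (snd (s + coord_vec (Inr \<delta>) \<zeta>))"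
        using q(1)[OF s] by (intro C(3)) auto
    qed
  qed
qed

lemma deriv_integrable:
  assumes p: "fst p \<in> U"
  shows "integrable lborel (\<lambda>\<zeta>. dir_deriv v (\<eta> (Inr \<delta>)) (p + coord_vec (Inr \<delta>) \<zeta>) / \<zeta>)"
proof -
  obtain r G where G: "r > 0" "integrable lborel G"
    "\<And>q \<zeta> v. q \<in> ball p r \<Longrightarrow> norm (dir_deriv v (\<eta> (Inr \<delta>)) (q + coord_vec (Inr \<delta>) \<zeta>) / \<zeta>) \<le> G \<zeta> * norm v"
    using local_majorant[OF p] by metis
  show ?thesis
  proof (rule integrable_dominated[OF _ shift_measurable(2)[OF p]])
    show "integrable lborel (\<lambda>\<zeta>. G \<zeta> * norm v)" using G(2) by simp
    show "norm (dir_deriv v (\<eta> (Inr \<delta>)) (p + coord_vec (Inr \<delta>) \<zeta>) / \<zeta>) \<le> G \<zeta> * norm v" for \<zeta>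
      by (rule G(3)) (simp only: centre_in_ball G(1))
  qed
qed

lemma fiber_cauchy_has_derivative:
  assumes p: "fst p \<in> U"
  shows "(fiber_cauchy \<eta> \<delta> has_derivative
    (\<lambda>v. - (LINT \<zeta>|lborel. dir_deriv v (\<eta> (Inr \<delta>)) (p + coord_vec (Inr \<delta>) \<zeta>) / \<zeta>) / pi)) (at p)"
proof -
  obtain r G where G: "r > 0" "integrable lborel G" "ball p r \<subseteq> U \<times> UNIV"
    "\<And>q \<zeta>. q \<in> ball p r \<Longrightarrow> norm (\<eta> (Inr \<delta>) (q + coord_vec (Inr \<delta>) \<zeta>) / \<zeta>) \<le> G \<zeta>"
    "\<And>q \<zeta> v. q \<in> ball p r \<Longrightarrow> norm (dir_deriv v (\<eta> (Inr \<delta>)) (q + coord_vec (Inr \<delta>) \<zeta>) / \<zeta>) \<le> G \<zeta> * norm v"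
    using local_majorant[OF p] by metis
  have U: "fst q \<in> U" if "q \<in> ball p r" for q using subsetD[OF G(3) that] by (simp add: mem_Times_iff)
  have "((\<lambda>q. LINT \<zeta>|lborel. \<eta> (Inr \<delta>) (q + coord_vec (Inr \<delta>) \<zeta>) / \<zeta>) has_derivative
    (\<lambda>v. LINT \<zeta>|lborel. dir_deriv v (\<eta> (Inr \<delta>)) (p + coord_vec (Inr \<delta>) \<zeta>) / \<zeta>)) (at p)"
  proof (rule has_derivative_lebesgue_integral[where N="ball p r" and G=G
        and f'="\<lambda>q \<zeta> v. dir_deriv v (\<eta> (Inr \<delta>)) (q + coord_vec (Inr \<delta>) \<zeta>) / \<zeta>"])
    fix q \<zeta> assume q: "q \<in> ball p r"
    have "((\<lambda>q. \<eta> (Inr \<delta>) (q + coord_vec (Inr \<delta>) \<zeta>)) has_derivative (\<lambda>v. dir_deriv v (\<eta> (Inr \<delta>)) (q + coord_vec (Inr \<delta>) \<zeta>))) (at q)"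
      by (rule has_derivative_compose[where f="\<lambda>q. q + coord_vec (Inr \<delta>) \<zeta>" and f'="\<lambda>v. v"])
        (rule has_derivative_add_const[OF has_derivative_ident], rule C1_on_has_derivative[OF C1 shift_mem[OF U[OF q]]])
    then show "((\<lambda>q. \<eta> (Inr \<delta>) (q + coord_vec (Inr \<delta>) \<zeta>) / \<zeta>) has_derivative
       (\<lambda>v. dir_deriv v (\<eta> (Inr \<delta>)) (q + coord_vec (Inr \<delta>) \<zeta>) / \<zeta>)) (at q)"
      by (rule bounded_linear.has_derivative[OF bounded_linear_divide])
  next
    fix q assume q: "q \<in> ball p r"
    show "integrable lborel (\<lambda>\<zeta>. \<eta> (Inr \<delta>) (q + coord_vec (Inr \<delta>) \<zeta>) / \<zeta>)"
      by (rule integrable_dominated[OF G(2) shift_measurable(1)[OF U[OF q]] G(4)[OF q]])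
  next
    show "(\<lambda>\<zeta>. dir_deriv v (\<eta> (Inr \<delta>)) (p + coord_vec (Inr \<delta>) \<zeta>) / \<zeta>) \<in> borel_measurable lborel" for v
      by (rule shift_measurable(2)[OF p])
    show "open (ball p r)" "convex (ball p r)" "p \<in> ball p r" using G(1) by simp_all
    show "integrable lborel G" by (rule G(2))
    show "norm (dir_deriv v (\<eta> (Inr \<delta>)) (q + coord_vec (Inr \<delta>) \<zeta>) / \<zeta>) \<le> G \<zeta> * norm v" if "q \<in> ball p r" for q \<zeta> v
      by (rule G(5)[OF that])
  qed
  then have "((\<lambda>q. - (LINT \<zeta>|lborel. \<eta> (Inr \<delta>) (q + coord_vec (Inr \<delta>) \<zeta>) / \<zeta>) / pi) has_derivative
    (\<lambda>v. - (LINT \<zeta>|lborel. dir_deriv v (\<eta> (Inr \<delta>)) (p + coord_vec (Inr \<delta>) \<zeta>) / \<zeta>) / pi)) (at p)"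
    by (intro bounded_linear.has_derivative[OF bounded_linear_divide] has_derivative_minus)
  then show ?thesis unfolding fiber_cauchy_def[abs_def] .
qed

lemma fiber_cauchy_C1: "C1_on (U \<times> UNIV) (fiber_cauchy \<eta> \<delta>)"
  unfolding C1_on_def
proof (intro conjI ballI allI)
  fix p assume "p \<in> U \<times> (UNIV :: (complex^'k) set)"
  then have "fst p \<in> U" by auto
  from fiber_cauchy_has_derivative[OF this] show "fiber_cauchy \<eta> \<delta> differentiable (at p)"
    unfolding differentiable_def by blast
next
  fix v
  \<comment> \<open>The majorant exists only locally, so continuity is obtained ball by
    ball.\<close>
  have loc: "\<exists>r>0. continuous_on (ball p r) (dir_deriv v (fiber_cauchy \<eta> \<delta>))" if p: "fst p \<in> U" for p
  proof -
    obtain r G where G: "r > 0" "integrable lborel G" "ball p r \<subseteq> U \<times> UNIV"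
      "\<And>q \<zeta> v. q \<in> ball p r \<Longrightarrow> norm (dir_deriv v (\<eta> (Inr \<delta>)) (q + coord_vec (Inr \<delta>) \<zeta>) / \<zeta>) \<le> G \<zeta> * norm v"
      using local_majorant[OF p] by metis
    have U: "fst q \<in> U" if "q \<in> ball p r" for q using subsetD[OF G(3) that] by (simp add: mem_Times_iff)
    have "continuous_on (ball p r) (\<lambda>q. LINT \<zeta>|lborel. dir_deriv v (\<eta> (Inr \<delta>)) (q + coord_vec (Inr \<delta>) \<zeta>) / \<zeta>)"
    proof (rule continuous_on_lebesgue_integral[where G="\<lambda>\<zeta>. G \<zeta> * norm v"])
      fix \<zeta>
      have "continuous_on (ball p r) (\<lambda>q. dir_deriv v (\<eta> (Inr \<delta>)) (q + coord_vec (Inr \<delta>) \<zeta>))"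
      proof (rule continuous_on_compose2[OF C1_on_continuous_dir_deriv[OF C1]])
        show "continuous_on (ball p r) (\<lambda>q. q + coord_vec (Inr \<delta>) \<zeta>)" by (intro continuous_intros)
        show "(\<lambda>q. q + coord_vec (Inr \<delta>) \<zeta>) ` ball p r \<subseteq> U \<times> UNIV" using shift_mem[OF U] by blast
      qed
      then show "continuous_on (ball p r) (\<lambda>q. dir_deriv v (\<eta> (Inr \<delta>)) (q + coord_vec (Inr \<delta>) \<zeta>) / \<zeta>)"
        by (rule bounded_linear.continuous_on[OF bounded_linear_divide])
    next
      show "integrable lborel (\<lambda>\<zeta>. G \<zeta> * norm v)" using G(2) by simp
      fix q assume q: "q \<in> ball p r"
      show "(\<lambda>\<zeta>. dir_deriv v (\<eta> (Inr \<delta>)) (q + coord_vec (Inr \<delta>) \<zeta>) / \<zeta>) \<in> borel_measurable lborel"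
        by (rule shift_measurable(2)[OF U[OF q]])
      show "norm (dir_deriv v (\<eta> (Inr \<delta>)) (q + coord_vec (Inr \<delta>) \<zeta>) / \<zeta>) \<le> G \<zeta> * norm v" for \<zeta>
        by (rule G(4)[OF q])
    qed
    then have "continuous_on (ball p r) (\<lambda>q. - (LINT \<zeta>|lborel. dir_deriv v (\<eta> (Inr \<delta>)) (q + coord_vec (Inr \<delta>) \<zeta>) / \<zeta>) / pi)"
      by (intro bounded_linear.continuous_on[OF bounded_linear_divide] continuous_on_minus)
    then have "continuous_on (ball p r) (dir_deriv v (fiber_cauchy \<eta> \<delta>))"
      by (rule continuous_on_eq) (simp only: dir_deriv_eq[OF fiber_cauchy_has_derivative[OF U]])
    then show ?thesis using G(1) by blast
  qed
  show "continuous_on (U \<times> UNIV) (dir_deriv v (fiber_cauchy \<eta> \<delta>))"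
  proof (rule continuous_at_imp_continuous_on, rule ballI)
    fix p assume "p \<in> U \<times> (UNIV :: (complex^'k) set)"
    then obtain r where "r > 0" "continuous_on (ball p r) (dir_deriv v (fiber_cauchy \<eta> \<delta>))"
      using loc[of p] by (auto simp only: mem_Times_iff)
    then show "isCont (dir_deriv v (fiber_cauchy \<eta> \<delta>)) p" by (simp add: continuous_on_eq_continuous_at)
  qed
qed

text \<open>Provides the behavior at infinity that \<open>Cauchy_Pompeiu_plane\<close> asks for, in
  two ways: for a base coefficient from the uniform limit, as
  \<open>w + axis \<delta> \<zeta>\<close> is at least as large as its \<delta> coordinate; for a
  fiber coefficient from the weight.\<close>

lemma shift_tendsto_0:
  assumes p: "fst p \<in> U"
  shows "((\<lambda>\<zeta>. \<eta> i (p + coord_vec (Inr \<delta>) \<zeta>)) \<longlongrightarrow> 0) at_infinity"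
proof -
  obtain \<epsilon> where eps: "decreasing_exponent \<eta> {fst p} \<epsilon>" using decreasing[of "{fst p}"] p by auto
  then have "\<epsilon> > 0" by (simp add: decreasing_exponent_def)
  have inf: "filterlim (\<lambda>\<zeta>. snd p $ \<delta> + \<zeta>) at_infinity at_infinity"
    by (rule tendsto_add_filterlim_at_infinity[OF tendsto_const filterlim_ident])
  show ?thesis
  proof (cases i)
    case (Inl \<alpha>)
    have "filterlim (\<lambda>\<zeta>. snd p + axis \<delta> \<zeta>) at_infinity at_infinity"
      unfolding filterlim_at_infinity_conv_norm_at_top
    proof (rule filterlim_at_top_mono)
      show "filterlim (\<lambda>\<zeta>. norm (snd p $ \<delta> + \<zeta>)) at_top at_infinity"
        using inf by (simp add: filterlim_at_infinity_conv_norm_at_top)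
      show "\<forall>\<^sub>F \<zeta> in at_infinity. norm (snd p $ \<delta> + \<zeta>) \<le> norm (snd p + axis \<delta> \<zeta>)"
        using Finite_Cartesian_Product.norm_nth_le[of "snd p + axis \<delta> _" \<delta>] by (intro always_eventually) (auto simp: axis_def)
    qed
    moreover have "((\<lambda>w. \<eta> (Inl \<alpha>) (fst p, w)) \<longlongrightarrow> 0) at_infinity"
      using eps unfolding decreasing_exponent_def by (auto intro: tendsto_uniform_limitI)
    ultimately have "((\<lambda>\<zeta>. \<eta> (Inl \<alpha>) (fst p, snd p + axis \<delta> \<zeta>)) \<longlongrightarrow> 0) at_infinity"
      using filterlim_compose by blast
    moreover have "(\<lambda>\<zeta>. \<eta> (Inl \<alpha>) (fst p, snd p + axis \<delta> \<zeta>)) = (\<lambda>\<zeta>. \<eta> (Inl \<alpha>) (p + coord_vec (Inr \<delta>) \<zeta>))"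
      by (simp add: plus_prod_def)
    ultimately show ?thesis using Inl by simp
  next
    case (Inr \<gamma>)
    obtain C where C: "C > 0" "\<And>q \<gamma>. fst q \<in> {fst p} \<Longrightarrow> norm (\<eta> (Inr \<gamma>) q) \<le> C / fiber_weight \<epsilon> (snd q)"
      using decreasing_exponent_bounds[OF eps] by metis
    have "((\<lambda>x. radial_weight \<epsilon> x) \<longlongrightarrow> 0) at_top"
      unfolding radial_weight_def using \<open>\<epsilon> > 0\<close> by real_asymp
    then have "((\<lambda>\<zeta>. radial_weight \<epsilon> (norm (snd p $ \<delta> + \<zeta>))) \<longlongrightarrow> 0) at_infinity"
      using inf unfolding filterlim_at_infinity_conv_norm_at_top by (rule filterlim_compose)
    then have l: "((\<lambda>\<zeta>. C * radial_weight \<epsilon> (norm (snd p $ \<delta> + \<zeta>))) \<longlongrightarrow> 0) at_infinity"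
      using tendsto_mult_right_zero by blast
    have "norm (\<eta> (Inr \<gamma>) (p + coord_vec (Inr \<delta>) \<zeta>)) \<le> C * radial_weight \<epsilon> (norm (snd p $ \<delta> + \<zeta>))" for \<zeta>
      using C(2)[of "p + coord_vec (Inr \<delta>) \<zeta>" \<gamma>] mult_left_mono[OF inverse_fiber_weight_le[of \<epsilon> "snd p" \<delta> \<zeta>], of C] C(1) by simp
    then have "((\<lambda>\<zeta>. \<eta> (Inr \<gamma>) (p + coord_vec (Inr \<delta>) \<zeta>)) \<longlongrightarrow> 0) at_infinity"
      by (intro Lim_null_comparison[OF _ l] always_eventually allI)
    then show ?thesis using Inr by simp
  qed
qed

text \<open>Closedness moves the derivative onto the coefficient \<open>\<eta> i\<close>, in the direction of the
  integration, so that the Cauchy--Pompeiu formula recovers \<open>\<eta> i\<close>.\<close>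

lemma fiber_cauchy_dbar:
  assumes p: "fst p \<in> U"
  shows "partial_bar i (fiber_cauchy \<eta> \<delta>) p = \<eta> i p"
proof -
  let ?e = "coord_vec (Inr \<delta>) :: complex \<Rightarrow> ('n, 'k) model"
  define g where "g \<zeta> = \<eta> i (p + ?e \<zeta>)" for \<zeta>
  have gd: "(g has_derivative (\<lambda>u. dir_deriv (?e u) (\<eta> i) (p + ?e \<zeta>))) (at \<zeta>)" for \<zeta>
  proof -
    have "((\<lambda>\<zeta>. p + ?e \<zeta>) has_derivative (\<lambda>u. 0 + ?e u)) (at \<zeta>)"
      by (intro has_derivative_add has_derivative_const bounded_linear_imp_has_derivative bounded_linear_coord_vec)
    then have "((\<lambda>\<zeta>. p + ?e \<zeta>) has_derivative ?e) (at \<zeta>)" unfolding add_0 .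
    then show ?thesis unfolding g_def
      by (rule has_derivative_compose[where g="\<eta> i"]) (rule C1_on_has_derivative[OF C1 shift_mem[OF p]])
  qed
  have g_dd: "dir_deriv u g \<zeta> = dir_deriv (?e u) (\<eta> i) (p + ?e \<zeta>)" for u \<zeta>
    by (rule dir_deriv_eq[OF gd])
  have gC1: "C1_on UNIV g"
    unfolding C1_on_def g_dd[abs_def] using gd continuous_shift(2)[OF p] by (auto simp: differentiable_def)
  have wb: "wirtinger_bar g \<zeta> = partial_bar i (\<eta> (Inr \<delta>)) (p + ?e \<zeta>)" for \<zeta>
  proof -
    have "wirtinger_bar g \<zeta> = partial_bar (Inr \<delta>) (\<eta> i) (p + ?e \<zeta>)"
      by (simp add: wirtinger_bar_def partial_bar_def g_dd)
    then show ?thesis using closed[OF shift_mem[OF p, of \<delta> \<zeta>], where i=i and j="Inr \<delta>"] by (simp add: dbar_coeff_def)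
  qed
  define d where "d c \<zeta> = dir_deriv (coord_vec i c) (\<eta> (Inr \<delta>)) (p + ?e \<zeta>) / \<zeta>" for c \<zeta>
  have I: "integrable lborel (d c)" for c unfolding d_def by (rule deriv_integrable[OF p])
  have eq: "(\<lambda>\<zeta>. wirtinger_bar g \<zeta> / \<zeta>) = (\<lambda>\<zeta>. (d 1 \<zeta> + \<i> * d \<i> \<zeta>) / 2)"
    unfolding wb partial_bar_def d_def by (auto simp: fun_eq_iff add_divide_distrib mult.commute)
  \<comment> \<open>The derivatives of a base coefficient carry no growth bound. Integrability is
    read off from the derivatives of \<open>\<eta> (Inr \<delta>)\<close>, into which
    \<open>wb\<close> has converted them.\<close>
  have "integrable lborel (\<lambda>\<zeta>. wirtinger_bar g \<zeta> / \<zeta>)" unfolding eq using I by auto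
  moreover have "(g \<longlongrightarrow> 0) at_infinity" unfolding g_def by (rule shift_tendsto_0[OF p])
  ultimately have CP: "(LINT \<zeta>|lborel. wirtinger_bar g \<zeta> / \<zeta>) = - pi * g 0"
    using gC1 by (intro Cauchy_Pompeiu_plane)
  have "partial_bar i (fiber_cauchy \<eta> \<delta>) p = - ((LINT \<zeta>|lborel. d 1 \<zeta>) + \<i> * (LINT \<zeta>|lborel. d \<i> \<zeta>)) / 2 / pi"
    unfolding partial_bar_def dir_deriv_eq[OF fiber_cauchy_has_derivative[OF p]] d_def by (simp add: field_simps)
  also have "\<dots> = - (LINT \<zeta>|lborel. wirtinger_bar g \<zeta> / \<zeta>) / pi"
    unfolding eq using I by (simp add: field_simps)
  also have "\<dots> = g 0" unfolding CP by simp
  finally show ?thesis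
    by (simp only: g_def linear_0[OF bounded_linear.linear[OF bounded_linear_coord_vec]] add_0_right)
qed

lemma fiber_cauchy_le_kernel_bound:
  assumes K: "K \<subseteq> U" and eps: "decreasing_exponent \<eta> K \<epsilon>"
  obtains c where "c > 0" "\<And>z w \<delta>. z \<in> K \<Longrightarrow> norm (fiber_cauchy \<eta> \<delta> (z, w)) \<le> c * kernel_bound \<epsilon> \<delta> w"
proof -
  have "\<epsilon> > 0" using eps by (simp add: decreasing_exponent_def)
  obtain C where C: "C > 0" "\<And>q \<gamma>. fst q \<in> K \<Longrightarrow> norm (\<eta> (Inr \<gamma>) q) \<le> C / fiber_weight \<epsilon> (snd q)"
    using decreasing_exponent_bounds[OF eps] by metis
  \<comment> \<open>The \<open>pi\<close> is the normalization of \<open>fiber_cauchy\<close>, the 2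
    offsets the factor in front of the integral in \<open>kernel_bound\<close>. The constant serves
    all \<delta> at once.\<close>
  have "norm (fiber_cauchy \<eta> \<delta> (z, w)) \<le> C / (2 * pi) * kernel_bound \<epsilon> \<delta> w" if z: "z \<in> K" for z w \<delta>
  proof -
    let ?f = "\<lambda>\<zeta>. \<eta> (Inr \<delta>) ((z, w) + coord_vec (Inr \<delta>) \<zeta>) / \<zeta>"
    let ?k = "\<lambda>\<zeta>. 1 / norm \<zeta> * (1 / fiber_weight \<epsilon> (w + axis \<delta> \<zeta>))"
    have le: "norm (?f \<zeta>) \<le> C * ?k \<zeta>" for \<zeta>
      using divide_right_mono[OF C(2)[of "(z, w) + coord_vec (Inr \<delta>) \<zeta>" \<delta>] norm_ge_zero[of \<zeta>]] z
      by (simp add: norm_divide mult.commute)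
    have k: "integrable lborel ?k" by (rule fiber_kernel_integrable[OF \<open>\<epsilon> > 0\<close>])
    have "norm (LINT \<zeta>|lborel. ?f \<zeta>) \<le> (LINT \<zeta>|lborel. C * ?k \<zeta>)"
    proof (rule Bochner_Integration.integral_norm_bound_integral)
      show "integrable lborel ?f"
        by (rule integrable_dominated[OF integrable_mult_right[OF k] shift_measurable(1) le])
          (use z K in auto)
      show "integrable lborel (\<lambda>\<zeta>. C * ?k \<zeta>)" by (rule integrable_mult_right[OF k])
    qed (rule le)
    then have "norm (LINT \<zeta>|lborel. ?f \<zeta>) \<le> C * (LINT \<zeta>|lborel. ?k \<zeta>)"
      by (simp only: integral_mult_right_zero)
    then show ?thesis by (simp add: fiber_cauchy_def kernel_bound_eq norm_divide divide_right_mono)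
  qed
  then show thesis using that[of "C / (2 * pi)"] C(1) by simp
qed

end

section \<open>Uniqueness on fibers and gluing\<close>

lemma coord_model_scale: "coord i (model_scale c v) = c * coord i v"
  by (cases i) (simp_all add: model_scale_def)

text \<open>A coordinate-free form of the equation: the left side is twice the antilinear part of
  \<open>F'\<close>. In this form the equation passes through a complex linear \<open>T'\<close>
  without any chain rule for conjugate derivatives.\<close>

lemma derivative_antilinear_part:
  assumes F: "(F has_derivative F') (at p)" and bar: "\<And>i. partial_bar i F p = \<eta> i p"
  shows "F' v + \<i> * F' (model_scale \<i> v) = 2 * form_eval \<eta> p v"
proof -
  have lin: "linear F'" using has_derivative_linear[OF F] .
  have bar': "F' (coord_vec i 1) + \<i> * F' (coord_vec i \<i>) = 2 * \<eta> i p" for i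
    using bar[of i] by (simp add: partial_bar_def dir_deriv_eq[OF F])
  have "F' v + \<i> * F' (model_scale \<i> v)
    = (\<Sum>i\<in>UNIV. cnj (coord i v) * (F' (coord_vec i 1) + \<i> * F' (coord_vec i \<i>)))"
    unfolding linear_model_expand[OF lin, of v] linear_model_expand[OF lin, of "model_scale \<i> v"]
      coord_model_scale sum_distrib_left sum.distrib[symmetric]
  proof (rule sum.cong[OF refl])
    fix i
    have c: "cnj (coord i v) = of_real (Re (coord i v)) - \<i> * of_real (Im (coord i v))"
      by (simp add: complex_eq_iff)
    show "Re (coord i v) *\<^sub>R F' (coord_vec i 1) + Im (coord i v) *\<^sub>R F' (coord_vec i \<i>)
      + \<i> * (Re (\<i> * coord i v) *\<^sub>R F' (coord_vec i 1) + Im (\<i> * coord i v) *\<^sub>R F' (coord_vec i \<i>))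
      = cnj (coord i v) * (F' (coord_vec i 1) + \<i> * F' (coord_vec i \<i>))"
      unfolding c by (simp add: scaleR_conv_of_real algebra_simps)
  qed
  also have "\<dots> = 2 * form_eval \<eta> p v"
    unfolding bar' form_eval_def by (simp add: sum_distrib_left mult_ac)
  finally show ?thesis .
qed

text \<open>Along the complex line through 0 and \<open>w\<close> the function is entire and
  bounded, so the one-variable Liouville theorem compares the parameters 1 and 0. Real linearity and
  compatibility with \<open>\<i>\<close> make the derivative along the line complex linear.\<close>

lemma bounded_holomorphic_vec_constant:
  fixes E :: "complex^'k::finite \<Rightarrow> complex"
  assumes der: "\<And>w. (E has_derivative E' w) (at w)"
    and lin: "\<And>w v. E' w (\<i> *s v) = \<i> * E' w v"
    and bounded: "\<And>w. norm (E w) \<le> M"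
  shows "E w = E 0"
proof -
  have "((\<lambda>c. E (c *s w)) has_field_derivative E' (c *s w) w) (at c)" for c
  proof -
    have l: "linear (E' (c *s w))" using has_derivative_linear[OF der] .
    have lw: "linear (\<lambda>v::complex. v *s w)"
      by (rule linearI) (simp_all add: vec_eq_iff algebra_simps)
    have "((\<lambda>c. c *s w) has_derivative (\<lambda>v. v *s w)) (at c)"
      using lw by (simp add: bounded_linear_imp_has_derivative linear_conv_bounded_linear)
    then have "((\<lambda>c. E (c *s w)) has_derivative (\<lambda>v. E' (c *s w) (v *s w))) (at c)"
      by (rule has_derivative_compose[OF _ der])
    moreover have "E' (c *s w) (v *s w) = E' (c *s w) w * v" for v
    proof -
      have "v *s w = Re v *\<^sub>R w + Im v *\<^sub>R (\<i> *s w)"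
        by (simp add: vec_eq_iff complex_eq_iff)
      then have "E' (c *s w) (v *s w) = Re v *\<^sub>R E' (c *s w) w + Im v *\<^sub>R (\<i> * E' (c *s w) w)"
        by (simp only: linear_add[OF l] linear_scale[OF l] lin)
      also have "\<dots> = (of_real (Re v) + \<i> * of_real (Im v)) * E' (c *s w) w"
        by (simp add: scaleR_conv_of_real algebra_simps)
      finally show ?thesis by (simp add: complex_eq[symmetric] mult.commute)
    qed
    ultimately show ?thesis by (simp add: has_field_derivative_def)
  qed
  then have "(\<lambda>c. E (c *s w)) holomorphic_on UNIV"
    by (auto simp: holomorphic_on_def field_differentiable_def)
  moreover have "bounded (range (\<lambda>c. E (c *s w)))" using bounded by (auto simp: bounded_iff)
  ultimately have "(\<lambda>c. E (c *s w)) constant_on UNIV" by (rule Liouville_theorem)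
  then obtain k where "\<And>c. E (c *s w) = k" unfolding constant_on_def by blast
  from this[of 1] this[of 0] show ?thesis by simp
qed

text \<open>Two bounded solutions over the same fiber, one of them transported by \<open>T\<close>, differ by a
  holomorphic function of the fiber coordinate, to which Liouville's theorem applies.\<close>

lemma dbar_solutions_eq_on_fiber:
  fixes F G :: "('n::finite, 'k::finite) model \<Rightarrow> complex" and T :: "('n, 'k) model \<Rightarrow> ('n, 'k) model"
  assumes T: "\<And>w. (T has_derivative T' w) (at (z, w))"
    and T': "\<And>w v. T' w (model_scale \<i> v) = model_scale \<i> (T' w v)"
    and F: "\<And>w. (F has_derivative F' w) (at (T (z, w)))" "\<And>w i. partial_bar i F (T (z, w)) = \<eta> i (T (z, w))"
    and G: "\<And>w. (G has_derivative G' w) (at (z, w))" "\<And>w i. partial_bar i G (z, w) = \<theta> i (z, w)"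
    and pullback: "\<And>w v. form_eval \<theta> (z, w) v = form_eval \<eta> (T (z, w)) (T' w v)"
    and bounded: "\<And>w. norm (F (T (z, w))) \<le> M" "\<And>w. norm (G (z, w)) \<le> N"
    and small: "\<And>e. e > 0 \<Longrightarrow> \<exists>w. norm (F (T (z, w))) < e \<and> norm (G (z, w)) < e"
  shows "F (T (z, w)) = G (z, w)"
proof -
  define E where "E w = F (T (z, w)) - G (z, w)" for w
  define E' where "E' w v = F' w (T' w (0, v)) - G' w (0, v)" for w v
  have der: "(E has_derivative E' w) (at w)" for w
  proof -
    have P: "((\<lambda>w. (z, w)) has_derivative (\<lambda>v. (0, v))) (at w)" by (auto intro!: derivative_eq_intros)
    have FT: "((\<lambda>w. F (T (z, w))) has_derivative (\<lambda>v. F' w (T' w (0, v)))) (at w)"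
      using has_derivative_compose[OF has_derivative_compose[OF P T] F(1)] .
    have "((\<lambda>w. G (z, w)) has_derivative (\<lambda>v. G' w (0, v))) (at w)"
      using has_derivative_compose[OF P G(1)] .
    then show ?thesis unfolding E_def[abs_def] E'_def[abs_def] using FT by (intro has_derivative_diff)
  qed
  have lin: "E' w (\<i> *s v) = \<i> * E' w v" for w v
  proof -
    have s: "model_scale \<i> (0, v) = (0, \<i> *s v)" by (simp add: model_scale_def)
    have "F' w (T' w (0, v)) + \<i> * F' w (model_scale \<i> (T' w (0, v))) = 2 * form_eval \<eta> (T (z, w)) (T' w (0, v))"
      by (rule derivative_antilinear_part) (rule F)+
    moreover have "G' w (0, v) + \<i> * G' w (model_scale \<i> (0, v)) = 2 * form_eval \<theta> (z, w) (0, v)"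
      by (rule derivative_antilinear_part) (rule G)+
    \<comment> \<open>Complex linearity of \<open>T'\<close> and the pullback identity make the two
      antilinear parts equal, so they cancel in \<open>E'\<close>.\<close>
    ultimately have "E' w v + \<i> * E' w (\<i> *s v) = 0"
      unfolding E'_def pullback T'[symmetric] s by (simp add: algebra_simps)
    then have "\<i> * (E' w v + \<i> * E' w (\<i> *s v)) = 0" by simp
    then show ?thesis by (simp add: algebra_simps)
  qed
  have "norm (E w) \<le> M + N" for w
    unfolding E_def by (rule order_trans[OF norm_triangle_ineq4 add_mono[OF bounded]])
  then have const: "E w = E 0" for w by (rule bounded_holomorphic_vec_constant[OF der lin])
  \<comment> \<open>The constant can be read off at any point of the fiber; a point where both
    solutions are small shows that it is 0.\<close>
  have "norm (E 0) \<le> e" if e: "e > 0" for e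
  proof -
    obtain w where w: "norm (F (T (z, w))) < e / 2" "norm (G (z, w)) < e / 2" using small[of "e / 2"] e by auto
    have "norm (E w) \<le> norm (F (T (z, w))) + norm (G (z, w))" unfolding E_def by (rule norm_triangle_ineq4)
    then show ?thesis using w const[of w] by simp
  qed
  then have "norm (E 0) \<le> 0" by (rule field_le_epsilon[of _ 0, simplified])
  then show ?thesis using const[of w] by (simp add: E_def)
qed

context decreasing_form begin

lemma fiber_cauchy_bounded_decay:
  assumes K: "compact K" "K \<subseteq> U"
  shows "\<exists>M. \<forall>z\<in>K. \<forall>w \<delta>. norm (fiber_cauchy \<eta> \<delta> (z, w)) \<le> M"
    "e > 0 \<Longrightarrow> \<exists>R. \<forall>z\<in>K. \<forall>w \<delta>. norm (w $ \<delta>) > R \<longrightarrow> norm (fiber_cauchy \<eta> \<delta> (z, w)) < e"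
proof -
  obtain \<epsilon> where eps: "decreasing_exponent \<eta> K \<epsilon>" using decreasing[OF K] by blast
  then have "\<epsilon> > 0" by (simp add: decreasing_exponent_def)
  obtain c where c: "c > 0" "\<And>z w \<delta>. z \<in> K \<Longrightarrow> norm (fiber_cauchy \<eta> \<delta> (z, w)) \<le> c * kernel_bound \<epsilon> \<delta> w"
    using fiber_cauchy_le_kernel_bound[OF K(2) eps] by metis
  obtain M where M: "\<And>\<delta> w. kernel_bound \<epsilon> \<delta> (w::complex^'k) \<le> M" using kernel_bound_bounded[OF \<open>\<epsilon> > 0\<close>] by metis
  have "norm (fiber_cauchy \<eta> \<delta> (z, w)) \<le> c * M" if "z \<in> K" for z w \<delta>
    using order_trans[OF c(2)[OF that] mult_left_mono[OF M]] c(1) by simp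
  then show "\<exists>M. \<forall>z\<in>K. \<forall>w \<delta>. norm (fiber_cauchy \<eta> \<delta> (z, w)) \<le> M" by blast
  show "\<exists>R. \<forall>z\<in>K. \<forall>w \<delta>. norm (w $ \<delta>) > R \<longrightarrow> norm (fiber_cauchy \<eta> \<delta> (z, w)) < e" if "e > 0"
  proof -
    obtain R where R: "\<And>\<delta> w. norm ((w::complex^'k) $ \<delta>) > R \<Longrightarrow> kernel_bound \<epsilon> \<delta> w < e / c"
      using kernel_bound_decay[OF \<open>\<epsilon> > 0\<close>, of "e / c"] \<open>e > 0\<close> c(1) by (metis divide_pos_pos)
    have "norm (fiber_cauchy \<eta> \<delta> (z, w)) < e" if "z \<in> K" "norm (w $ \<delta>) > R" for z w \<delta>
      using order.strict_trans1[OF c(2)[OF that(1)] mult_strict_left_mono[OF R[OF that(2)] c(1)]] c(1) by simp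
    then show ?thesis by blast
  qed
qed

text \<open>Uniqueness with \<open>T\<close> the identity. The two transforms are known to decay in
  different coordinates, so smallness is tested at a point all of whose coordinates are
  large.\<close>

lemma fiber_cauchy_independent:
  assumes z: "z \<in> U"
  shows "fiber_cauchy \<eta> \<delta> (z, w) = fiber_cauchy \<eta> \<gamma> (z, w)"
proof -
  have K: "compact {z}" "{z} \<subseteq> U" using z by auto
  obtain M where M: "\<And>w \<delta>. norm (fiber_cauchy \<eta> \<delta> (z, w)) \<le> M" using fiber_cauchy_bounded_decay(1)[OF K] by blast
  have small: "\<exists>w. norm (fiber_cauchy \<eta> \<delta> (z, w)) < e \<and> norm (fiber_cauchy \<eta> \<gamma> (z, w)) < e" if e: "e > 0" for e
  proof -
    obtain R where R: "\<And>w \<delta>. norm (w $ \<delta>) > R \<Longrightarrow> norm (fiber_cauchy \<eta> \<delta> (z, w)) < e"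
      using fiber_cauchy_bounded_decay(2)[OF K e] by blast
    have "norm (complex_of_real (\<bar>R\<bar> + 1)) > R" by (simp only: norm_of_real)
    then have "norm ((\<chi> j. complex_of_real (\<bar>R\<bar> + 1)) $ j) > R" for j :: 'k by simp
    then show ?thesis using R by blast
  qed
  have U: "fst (z, w) \<in> U" for w :: "complex^'k" using z by simp
  show ?thesis
    by (rule dbar_solutions_eq_on_fiber[where T="\<lambda>p. p" and T'="\<lambda>_ v. v" and \<eta>=\<eta> and \<theta>=\<eta>,
          OF has_derivative_ident refl fiber_cauchy_has_derivative[OF U] fiber_cauchy_dbar[OF U]
          fiber_cauchy_has_derivative[OF U] fiber_cauchy_dbar[OF U] refl M M small])
qed

text \<open>Since \<open>norm w\<close> is at most the sum of the moduli of its
  \<open>CARD('k)\<close> coordinates, some coordinate \<open>j\<close> exceeds \<open>R\<close>.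
  The transform for \<delta> equals the one for \<open>j\<close>, which decays in that
  coordinate.\<close>

lemma fiber_cauchy_vanishes_at_infinity:
  assumes z: "z \<in> U" and e: "e > 0"
  shows "\<exists>R. \<forall>w. norm w > R \<longrightarrow> norm (fiber_cauchy \<eta> \<delta> (z, w)) < e"
proof -
  obtain R where R: "\<And>w \<delta>. norm (w $ \<delta>) > R \<Longrightarrow> norm (fiber_cauchy \<eta> \<delta> (z, w)) < e"
    using fiber_cauchy_bounded_decay(2)[of "{z}", OF _ _ e] z by auto
  have "norm (fiber_cauchy \<eta> \<delta> (z, w)) < e" if w: "norm w > real CARD('k) * R" for w
  proof -
    have "\<exists>j. norm (w $ j) > R"
    proof (rule ccontr)
      assume "\<nexists>j. norm (w $ j) > R"
      then have "(\<Sum>j\<in>UNIV. norm (w $ j)) \<le> (\<Sum>j\<in>(UNIV::'k set). R)" by (intro sum_mono) (simp add: not_less)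
      moreover have "norm w \<le> (\<Sum>j\<in>UNIV. norm (w $ j))" unfolding norm_vec_def by (rule L2_set_le_sum) simp
      ultimately show False using w by simp
    qed
    then obtain j where "norm (w $ j) > R" by blast
    then show ?thesis using R[of w j] fiber_cauchy_independent[OF z, of \<delta> w j] by simp
  qed
  then show ?thesis by blast
qed

end

section \<open>Agreement on chart overlaps and the global solution\<close>

lemma biholomorphism_imp_large_pair:
  assumes "biholomorphism h"
  shows "\<exists>w. norm w > R \<and> norm (h w) > R'"
proof -
  have bij: "bij h" and hol: "holomorphic_map_on (*s) (*s) UNIV (inv h)"
    using assms by (auto simp: biholomorphism_def)
  have "isCont (inv h) v" for v
    using hol has_derivative_continuous unfolding holomorphic_map_on_def by blast
  \<comment> \<open>Properness of \<open>h\<close>: the preimage of a ball is compact, so any point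
    far enough out has a large image as well.\<close>
  then have "compact (inv h ` cball 0 R')"
    by (intro compact_continuous_image continuous_at_imp_continuous_on) auto
  then have "bounded (inv h ` cball 0 R')" by (rule compact_imp_bounded)
  then obtain m where m: "\<And>v. v \<in> cball 0 R' \<Longrightarrow> norm (inv h v) \<le> m"
    unfolding bounded_iff by blast
  obtain w :: "complex^'a" where w: "norm w = max \<bar>R\<bar> \<bar>m\<bar> + 1"
    using vector_choose_size[of "max \<bar>R\<bar> \<bar>m\<bar> + 1"] by (metis abs_ge_zero add_nonneg_nonneg max.coboundedI1 zero_le_one)
  have "norm (h w) > R'"
  proof (rule ccontr)
    assume "\<not> norm (h w) > R'"
    then have "norm (inv h (h w)) \<le> m" by (intro m) simp
    then show False using w bij by (simp add: bij_is_inj)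
  qed
  then show ?thesis using w by (intro exI[of _ w]) auto
qed

lemma dir_deriv_cong_open:
  assumes "open A" "p \<in> A" "\<And>q. q \<in> A \<Longrightarrow> f q = g q"
  shows "dir_deriv v f p = dir_deriv v g p"
proof -
  have "(f has_derivative f') (at p) \<longleftrightarrow> (g has_derivative f') (at p)" for f'
    using has_derivative_transform_within_open[of f f' p UNIV A g]
      has_derivative_transform_within_open[of g f' p UNIV A f] assms by auto
  then show ?thesis by (simp add: dir_deriv_def frechet_derivative_def)
qed

lemma C1_on_cong_open:
  assumes "open A" "\<And>q. q \<in> A \<Longrightarrow> f q = g q" "C1_on A f"
  shows "C1_on A g"
  unfolding C1_on_def
proof (intro conjI ballI allI)
  fix p assume "p \<in> A"
  then show "g differentiable (at p)"
    using has_derivative_transform_within_open[OF C1_on_has_derivative[OF assms(3)] assms(1)] assms(2)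
    unfolding differentiable_def by blast
next
  fix v
  have "continuous_on A (dir_deriv v f)" using assms(3) unfolding C1_on_def by blast
  then show "continuous_on A (dir_deriv v g)"
    by (rule continuous_on_eq) (rule dir_deriv_cong_open[OF assms(1) _ assms(2)])
qed

lemma (in fiber_bundle) chart_inj:
  assumes "s \<in> S" shows "inj_on (\<phi> s) (D s)"
proof -
  have "topspace (subtopology X (D s)) = D s"
    using openin_subset[OF chart_open[OF assms]] by (auto simp: topspace_subtopology)
  then show ?thesis using homeomorphic_imp_injective_map[OF chart_homeo[OF assms]] by simp
qed

text \<open>Over a fixed \<open>z\<close> in the overlap the transition map sends the whole fiber
  biholomorphically onto the fiber over \<open>f z\<close>, so uniqueness on fibers applies with
  \<open>T\<close> the transition map. The point of common smallness comes from properness of the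
  fiber map and decay as \<open>norm w\<close> grows in both charts.\<close>

lemma (in fiber_bundle) chart_solutions_agree:
  assumes forms: "C1_form01 S D \<phi> \<omega>"
    and local: "\<And>s. s \<in> S \<Longrightarrow> decreasing_form (\<omega> s) (U s)"
    and s: "s \<in> S" and t: "t \<in> S" and x: "x \<in> D s" "x \<in> D t"
  shows "fiber_cauchy (\<omega> s) \<delta> (\<phi> s x) = fiber_cauchy (\<omega> t) \<delta> (\<phi> t x)"
proof -
  interpret s: decreasing_form "\<omega> s" "U s" by (rule local[OF s])
  interpret t: decreasing_form "\<omega> t" "U t" by (rule local[OF t])
  let ?T = "transition D \<phi> s t"
  have T: "?T (\<phi> t y) = \<phi> s y" if "y \<in> D t" for y
    using chart_inj[OF t] that by (simp add: transition_def)
  obtain V f g where Vfg: "\<phi> t ` (D s \<inter> D t) = V \<times> UNIV \<and>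
      (\<forall>z\<in>V. \<forall>w. ?T (z, w) = (f z, g z w)) \<and> (\<forall>z\<in>V. biholomorphism (g z))"
    using transition_fibered[OF s t] by (elim exE) (rule that)
  have V: "\<phi> t ` (D s \<inter> D t) = V \<times> UNIV" by (rule conjunct1[OF Vfg])
  have fg: "\<And>z w. z \<in> V \<Longrightarrow> ?T (z, w) = (f z, g z w)" and bih: "\<And>z. z \<in> V \<Longrightarrow> biholomorphism (g z)"
    using conjunct2[OF Vfg] by blast+
  obtain z w where zw: "\<phi> t x = (z, w)" by (cases "\<phi> t x")
  have "\<phi> t x \<in> V \<times> UNIV" unfolding V[symmetric] using x by simp
  then have z: "z \<in> V" using zw by simp
  \<comment> \<open>Overlaps consist of whole fibers; otherwise Liouville's theorem could not be
    used.\<close>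
  have memV: "(z, w) \<in> \<phi> t ` (D s \<inter> D t)" for w unfolding V using z by simp
  have Us: "fst (?T (z, w)) \<in> U s" and Ut: "fst (z, w) \<in> U t" for w
  proof -
    obtain y where y: "y \<in> D s" "y \<in> D t" "(z, w) = \<phi> t y"
      by (rule imageE[OF memV[of w]]) auto
    have "\<phi> s y \<in> U s \<times> UNIV" "\<phi> t y \<in> U t \<times> UNIV"
      unfolding chart_image[OF s, symmetric] chart_image[OF t, symmetric] using y by simp_all
    then show "fst (?T (z, w)) \<in> U s" "fst (z, w) \<in> U t" using T[OF y(2)] y(3) by (auto simp: mem_Times_iff)
  qed
  have fz: "f z \<in> U s" and zt: "z \<in> U t" using Us[of w] Ut[of w] fg[OF z] by auto
  have ex: "\<forall>w. \<exists>T'. (?T has_derivative T') (at (z, w)) \<and> (\<forall>c v. T' (model_scale c v) = model_scale c (T' v))"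
    using transition_holomorphic[OF s t, unfolded holomorphic_map_on_def] memV by blast
  obtain T' where "\<forall>w. (?T has_derivative T' w) (at (z, w)) \<and> (\<forall>c v. T' w (model_scale c v) = model_scale c (T' w v))"
    using choice[OF ex] by (elim exE) (rule that)
  then have T': "\<And>w. (?T has_derivative T' w) (at (z, w))"
    "\<And>w c v. T' w (model_scale c v) = model_scale c (T' w v)" by blast+
  have pull: "form_eval (\<omega> t) (z, w) v = form_eval (\<omega> s) (?T (z, w)) (T' w v)" for w v
  proof -
    have "\<forall>p\<in>\<phi> t ` (D s \<inter> D t). \<forall>v. form_eval (\<omega> t) p v = form_eval (\<omega> s) (?T p) (dir_deriv v ?T p)"
      using forms s t unfolding C1_form01_def by simp
    from bspec[OF this memV[of w]] show ?thesis by (simp only: dir_deriv_eq[OF T'(1)])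
  qed
  obtain M where M: "\<And>w. norm (fiber_cauchy (\<omega> s) \<delta> (f z, w)) \<le> M"
    using s.fiber_cauchy_bounded_decay(1)[of "{f z}"] fz by auto
  obtain N where N: "\<And>w. norm (fiber_cauchy (\<omega> t) \<delta> (z, w)) \<le> N"
    using t.fiber_cauchy_bounded_decay(1)[of "{z}"] zt by auto
  have small: "\<exists>w. norm (fiber_cauchy (\<omega> s) \<delta> (?T (z, w))) < e \<and> norm (fiber_cauchy (\<omega> t) \<delta> (z, w)) < e" if e: "e > 0" for e
  proof -
    obtain R R' where "\<And>w. norm w > R \<Longrightarrow> norm (fiber_cauchy (\<omega> s) \<delta> (f z, w)) < e"
      "\<And>w. norm w > R' \<Longrightarrow> norm (fiber_cauchy (\<omega> t) \<delta> (z, w)) < e"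
      using s.fiber_cauchy_vanishes_at_infinity[OF fz e] t.fiber_cauchy_vanishes_at_infinity[OF zt e] by metis
    then show ?thesis using biholomorphism_imp_large_pair[OF bih[OF z], of R' R] fg[OF z] by auto
  qed
  have "fiber_cauchy (\<omega> s) \<delta> (?T (z, w)) = fiber_cauchy (\<omega> t) \<delta> (z, w)"
  proof (rule dbar_solutions_eq_on_fiber[where F="fiber_cauchy (\<omega> s) \<delta>" and G="fiber_cauchy (\<omega> t) \<delta>"
        and T="?T" and T'=T' and \<eta>="\<omega> s" and \<theta>="\<omega> t", OF T'(1) T'(2) s.fiber_cauchy_has_derivative[OF Us]
        s.fiber_cauchy_dbar[OF Us] t.fiber_cauchy_has_derivative[OF Ut] t.fiber_cauchy_dbar[OF Ut] pull _ N small])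
    show "norm (fiber_cauchy (\<omega> s) \<delta> (?T (z, w))) \<le> M" for w using M fg[OF z] by simp
  qed
  then show ?thesis using T[OF x(2)] zw by simp
qed

theorem theorem2:
  fixes X :: "'x topology"
    and S :: "'s set"
    and D :: "'s \<Rightarrow> 'x set"
    and U :: "'s \<Rightarrow> (complex^'n::finite) set"
    and \<phi> :: "'s \<Rightarrow> 'x \<Rightarrow> ('n, 'k::finite) model"
    and \<omega> :: "'s \<Rightarrow> ('n, 'k) form01"
  assumes fibered: "fiber_bundle X S D U \<phi>"
    and form: "C1_form01 S D \<phi> \<omega>"
    and closed: "dbar_closed S D \<phi> \<omega>"
    and decreasing: "decreasing_along_fibers S U \<omega>"
  shows "\<exists>B :: 'x \<Rightarrow> complex.
    C1_function S D \<phi> B \<and>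
    dbar_eq S D \<phi> B \<omega> \<and>
    (\<forall>s\<in>S. \<forall>K \<epsilon>. compact K \<and> K \<subseteq> U s \<and> decreasing_exponent (\<omega> s) K \<epsilon> \<longrightarrow>
       (\<exists>c>0. \<forall>z\<in>K. \<forall>w. \<forall>\<delta>.
          norm (local_rep D \<phi> s B (z, w)) \<le> c * kernel_bound \<epsilon> \<delta> w)) \<and>
    (\<forall>s\<in>S. \<forall>K. compact K \<and> K \<subseteq> U s \<longrightarrow>
       bounded (local_rep D \<phi> s B ` (K \<times> UNIV))) \<and>
    (\<forall>s\<in>S. \<forall>K. compact K \<and> K \<subseteq> U s \<longrightarrow>
       (\<forall>\<delta>. \<forall>e>0. \<exists>R. \<forall>z\<in>K. \<forall>w. norm (w $ \<delta>) > R \<longrightarrow>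
          norm (local_rep D \<phi> s B (z, w)) < e))"
proof -
  interpret fiber_bundle X S D U \<phi> by (rule fibered)
  have local: "decreasing_form (\<omega> s) (U s)" if s: "s \<in> S" for s
  proof
    show "open (U s)" using base_domain[OF s] by blast
    show "C1_on (U s \<times> UNIV) (\<omega> s i)" for i
      using form s chart_image[OF s] unfolding C1_form01_def by auto
    show "dbar_coeff (\<omega> s) i j p = 0" if "p \<in> U s \<times> UNIV" for p i j
    proof -
      have "p \<in> \<phi> s ` D s" using that unfolding chart_image[OF s] .
      with closed s show ?thesis by (simp only: dbar_closed_def)
    qed
    show "\<exists>\<epsilon>. decreasing_exponent (\<omega> s) K \<epsilon>" if "compact K" "K \<subseteq> U s" for K
      using decreasing s that unfolding decreasing_along_fibers_def by blast
  qed
  \<comment> \<open>An arbitrary but fixed fiber index; by independence of \<delta> every choice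
    gives the same function over \<open>U s\<close>.\<close>
  define F where "F s = fiber_cauchy (\<omega> s) undefined" for s
  define B where "B x = (let s = SOME s. s \<in> S \<and> x \<in> D s in F s (\<phi> s x))" for x
  have B_chart: "B x = F s (\<phi> s x)" if s: "s \<in> S" "x \<in> D s" for s x
  proof -
    define t where "t = (SOME s. s \<in> S \<and> x \<in> D s)"
    have t: "t \<in> S \<and> x \<in> D t"
      unfolding t_def by (rule someI[of _ s]) (intro conjI s)
    have "B x = F t (\<phi> t x)" unfolding B_def t_def Let_def ..
    also have "\<dots> = F s (\<phi> s x)"
      unfolding F_def by (rule chart_solutions_agree[OF form local conjunct1[OF t] s(1) conjunct2[OF t] s(2)])
    finally show ?thesis .
  qed
  have rep: "local_rep D \<phi> s B p = F s p" if s: "s \<in> S" and p: "p \<in> U s \<times> UNIV" for s p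
  proof -
    have p': "p \<in> \<phi> s ` D s" using p unfolding chart_image[OF s] .
    show ?thesis
      unfolding local_rep_def B_chart[OF s inv_into_into[OF p']] f_inv_into_f[OF p'] ..
  qed
  \<comment> \<open>Releases the index fixed in \<open>F\<close>: since \<delta> is free, the one
    function \<open>B\<close> inherits the kernel bound and the decay for every \<delta>.\<close>
  have rep_at: "local_rep D \<phi> s B (z, w) = fiber_cauchy (\<omega> s) \<delta> (z, w)" if "s \<in> S" "z \<in> U s" for s z w \<delta>
    using rep[OF that(1), of "(z, w)"] that(2) decreasing_form.fiber_cauchy_independent[OF local[OF that(1)] that(2)]
    by (simp add: F_def)
  have op: "open (U s \<times> (UNIV :: (complex^'k) set))" if "s \<in> S" for s
    using base_domain[OF that] by (intro open_Times) auto
  show ?thesis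
  proof (intro exI[of _ B] conjI)
    show "C1_function S D \<phi> B"
      unfolding C1_function_def
    proof
      fix s assume s: "s \<in> S"
      show "C1_on (\<phi> s ` D s) (local_rep D \<phi> s B)"
        unfolding chart_image[OF s]
        by (rule C1_on_cong_open[OF op[OF s] rep[OF s, symmetric]])
          (simp_all only: F_def decreasing_form.fiber_cauchy_C1[OF local[OF s]])
    qed
    show "dbar_eq S D \<phi> B \<omega>"
      unfolding dbar_eq_def
    proof (intro ballI allI)
      fix s i p assume s: "s \<in> S" and p: "p \<in> \<phi> s ` D s"
      have p: "p \<in> U s \<times> UNIV" using p chart_image[OF s] by simp
      have "partial_bar i (local_rep D \<phi> s B) p = partial_bar i (F s) p"
        unfolding partial_bar_def using dir_deriv_cong_open[OF op[OF s] p rep[OF s]] by simp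
      also have "\<dots> = \<omega> s i p"
        unfolding F_def using p by (intro decreasing_form.fiber_cauchy_dbar[OF local[OF s]]) (simp add: mem_Times_iff)
      finally show "partial_bar i (local_rep D \<phi> s B) p = \<omega> s i p" .
    qed
    show "\<forall>s\<in>S. \<forall>K \<epsilon>. compact K \<and> K \<subseteq> U s \<and> decreasing_exponent (\<omega> s) K \<epsilon> \<longrightarrow>
       (\<exists>c>0. \<forall>z\<in>K. \<forall>w. \<forall>\<delta>. norm (local_rep D \<phi> s B (z, w)) \<le> c * kernel_bound \<epsilon> \<delta> w)"
    proof (intro ballI allI impI, elim conjE)
      fix s K \<epsilon> assume s: "s \<in> S" and K: "K \<subseteq> U s" "decreasing_exponent (\<omega> s) K \<epsilon>"
      obtain c where c: "c > 0" "\<And>z w \<delta>. z \<in> K \<Longrightarrow> norm (fiber_cauchy (\<omega> s) \<delta> (z, w)) \<le> c * kernel_bound \<epsilon> \<delta> w"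
        using decreasing_form.fiber_cauchy_le_kernel_bound[OF local[OF s] K] by metis
      have "norm (local_rep D \<phi> s B (z, w)) \<le> c * kernel_bound \<epsilon> \<delta> w" if "z \<in> K" for z w \<delta>
        using c(2)[OF that, of \<delta> w] rep_at[OF s, of z w \<delta>] that K(1) by auto
      then show "\<exists>c>0. \<forall>z\<in>K. \<forall>w. \<forall>\<delta>. norm (local_rep D \<phi> s B (z, w)) \<le> c * kernel_bound \<epsilon> \<delta> w"
        using c(1) by blast
    qed
    show "\<forall>s\<in>S. \<forall>K. compact K \<and> K \<subseteq> U s \<longrightarrow> bounded (local_rep D \<phi> s B ` (K \<times> UNIV))"
    proof (intro ballI allI impI, elim conjE)
      fix s K assume s: "s \<in> S" and K: "compact K" "K \<subseteq> U s"
      obtain M where M: "\<And>z w \<delta>. z \<in> K \<Longrightarrow> norm (fiber_cauchy (\<omega> s) \<delta> (z, w)) \<le> M"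
        using decreasing_form.fiber_cauchy_bounded_decay(1)[OF local[OF s] K] by blast
      have "norm (local_rep D \<phi> s B (z, w)) \<le> M" if "z \<in> K" for z w
        using M[OF that, of undefined w] rep_at[OF s, of z w undefined] that K(2) by auto
      then show "bounded (local_rep D \<phi> s B ` (K \<times> UNIV))" unfolding bounded_iff by blast
    qed
    show "\<forall>s\<in>S. \<forall>K. compact K \<and> K \<subseteq> U s \<longrightarrow>
       (\<forall>\<delta>. \<forall>e>0. \<exists>R. \<forall>z\<in>K. \<forall>w. norm (w $ \<delta>) > R \<longrightarrow> norm (local_rep D \<phi> s B (z, w)) < e)"
    proof (intro ballI allI impI, elim conjE)
      fix s K \<delta> and e :: real assume s: "s \<in> S" and K: "compact K" "K \<subseteq> U s" and e: "e > 0"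
      obtain R where R: "\<And>z w \<delta>. z \<in> K \<Longrightarrow> norm (w $ \<delta>) > R \<Longrightarrow> norm (fiber_cauchy (\<omega> s) \<delta> (z, w)) < e"
        using decreasing_form.fiber_cauchy_bounded_decay(2)[OF local[OF s] K e] by blast
      have "norm (local_rep D \<phi> s B (z, w)) < e" if "z \<in> K" "norm (w $ \<delta>) > R" for z w
        using R[OF that] rep_at[OF s, of z w \<delta>] that(1) K(2) by auto
      then show "\<exists>R. \<forall>z\<in>K. \<forall>w. norm (w $ \<delta>) > R \<longrightarrow> norm (local_rep D \<phi> s B (z, w)) < e" by blast
    qed
  qed
qed

end
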